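(* Let $(\mathcal X,d,\mu)$ be a space of homogeneous type and assume that the operators $T_t$, $t>0$, are linear. Then $\{T_t\}_{t>0}$ satisfies $L^1(\mu)-L^\infty(\mu)$ off-diagonal estimates on balls if and only if there exist constants $C,c>0$ and, for each $t>0$, a measurable function $K_t$ on $\mathcal X\times\mathcal X$ such that $T_tf(x)=\int_{\mathcal X}K_t(x,y)f(y)\,d\mu(y)$ holds for almost every $x\in\mathcal X$ whenever $f\in L^1(\mu)$, and for almost every $(x,y)\in\mathcal X\times\mathcal X$ $$|K_t(x,y)|\le \frac{C}{\mu(B(x,\sqrt t))}\,e^{-\frac{c\,d^2(x,y)}{t}}.$$
   Context: A space of homogeneous type $(\mathcal X,d,\mu)$ is a nonempty set $\mathcal X$ with a distance $d$ and a nonnegative Borel measure $\mu$ such that for some $C_0$, $\mu(B(x,2r))\le C_0\,\mu(B(x,r))<\infty$ for all $x\in\mathcal X$, $r>0$, where $B(x,r)=\{y:d(x,y)<r\}$. For a ball $B=B(x_B,r_B)$ write $\lambda B=B(x_B,\lambda r_B)$ and $C_j(B)=2^{j+1}B\setminus 2^jB$ for $j\ge2$. Put $\Upsilon(s)=\max\{s,s^{-1}\}$ for $s>0$; $\chi_E$ is the indicator function of $E$. For $1\le p\le q\le\infty$, $\{T_t\}_{t>0}$ satisfies $L^p(\mu)-L^q(\mu)$ off-diagonal estimates on balls if there exist $\theta_1,\theta_2>0$, $c>0$ and $C>0$ such that for every $t>0$, every ball $B$ with radius $r=r_B$, and all $f$, $$\Big(\tfrac1{\mu(B)}\int_B|T_t(\chi_Bf)|^q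 d\mu\Big)^{1/q}\le C\,\Upsilon\big(\tfrac r{\sqrt t}\big)^{\theta_2}\Big(\tfrac1{\mu(B)}\int_B|f|^pd\mu\Big)^{1/p},$$ and for all $j\ge2$ $$\Big(\tfrac1{\mu(B)}\int_B|T_t(\chi_{C_j(B)}f)|^q d\mu\Big)^{1/q}\le C\,2^{j\theta_1}\Upsilon\big(\tfrac{2^jr}{\sqrt t}\big)^{\theta_2}e^{-\frac{c4^jr^2}{t}}\Big(\tfrac1{\mu(2^{j+1}B)}\int_{C_j(B)}|f|^pd\mu\Big)^{1/p},$$ $$\Big(\tfrac1{\mu(2^{j+1}B)}\int_{C_j(B)}|T_t(\chi_{B}f)|^q d\mu\Big)^{1/q}\le C\,2^{j\theta_1}\Upsilon\big(\tfrac{2^jr}{\sqrt t}\big)^{\theta_2}e^{-\frac{c4^jr^2}{t}}\Big(\tfrac1{\mu(B)}\int_{B}|f|^pd\mu\Big)^{1/p}.$$ When $q=\infty$ the $L^q$ expressions on the left are replaced by essential suprema over $B$, $B$, $C_j(B)$ respectively. In this definition the operators may be defined only on a subspace of $L^p(\mu)$ that is stable under truncation by indicator functions of measurable sets, in which case the estimates are for $f$ in this subspace.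
   Formalization: Added assumption: for f in the domain of T_t, T_t(χ_{B(z,n)}f) tends to T_t f in measure on balls. Linearity alone does not suffice: adding to the heat semigroup a linear functional that vanishes on boundedly supported f keeps the estimates but destroys the kernel formula. *)

theory Defs
  imports "HOL-Probability.Probability"
begin

text \<open>The underlying set is the whole type, which carries the distance.\<close>

definition space_of_homogeneous_type :: "('a::metric_space) measure \<Rightarrow> bool" where
  "space_of_homogeneous_type M \<longleftrightarrow> sets M = sets borel \<and>
     (\<exists>C0::real. \<forall>x r. 0 < r \<longrightarrow>
        emeasure M (ball x (2 * r)) \<le> ennreal C0 * emeasure M (ball x r) \<and>
        ennreal C0 * emeasure M (ball x r) < \<infinity>)"

definition annulus :: "'a::metric_space \<Rightarrow> real \<Rightarrow> nat \<Rightarrow> 'a set" where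
  "annulus x r j = ball x (2 ^ (j + 1) * r) - ball x (2 ^ j * r)"

definition Upsilon :: "real \<Rightarrow> real" where
  "Upsilon s = max s (1 / s)"

definition trunc :: "'a set \<Rightarrow> ('a \<Rightarrow> complex) \<Rightarrow> 'a \<Rightarrow> complex" where
  "trunc A f = (\<lambda>x. indicator A x * f x)"

definition ennroot :: "real \<Rightarrow> ennreal \<Rightarrow> ennreal" where
  "ennroot p a = (if a = \<infinity> then \<infinity> else ennreal (enn2real a powr (1 / p)))"

text \<open>The integral runs over \<open>A\<close> but is normalised by the measure of \<open>E\<close>: the estimates
  average over an annulus with the measure of the enclosing ball. For \<open>p = \<infinity>\<close> this is
  the essential supremum over \<open>A\<close>. The value may be \<open>\<infinity>\<close>.\<close>

definition avg_norm :: "'a measure \<Rightarrow> ennreal \<Rightarrow> 'a set \<Rightarrow> 'a set \<Rightarrow> ('a \<Rightarrow> complex) \<Rightarrow> ennreal" where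
  "avg_norm M p E A f =
     (if p = \<infinity> then esssup M (\<lambda>x. indicator A x * ennreal (norm (f x)))
      else ennroot (enn2real p)
        ((\<integral>\<^sup>+x\<in>A. ennreal (norm (f x) powr enn2real p) \<partial>M) / emeasure M E))"

text \<open>The domain \<open>D\<close> of the operators is a complex linear space of functions that is stable
  under truncation. The operators act on functions modulo equality almost everywhere, and
  their values are representatives of measurable functions.\<close>

definition truncation_stable_subspace :: "'a measure \<Rightarrow> ('a \<Rightarrow> complex) set \<Rightarrow> bool" where
  "truncation_stable_subspace M D \<longleftrightarrow>
     (\<lambda>x. 0) \<in> D \<and>
     (\<forall>f\<in>D. \<forall>g\<in>D. (\<lambda>x. f x + g x) \<in> D) \<and>
     (\<forall>a. \<forall>f\<in>D. (\<lambda>x. a * f x) \<in> D) \<and>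
     (\<forall>A\<in>sets M. \<forall>f\<in>D. trunc A f \<in> D)"

definition operator_on ::
  "'a measure \<Rightarrow> ('a \<Rightarrow> complex) set \<Rightarrow> (('a \<Rightarrow> complex) \<Rightarrow> 'a \<Rightarrow> complex) \<Rightarrow> bool" where
  "operator_on M D S \<longleftrightarrow>
     (\<forall>f\<in>D. S f \<in> borel_measurable M) \<and>
     (\<forall>f\<in>D. \<forall>g\<in>D. (AE x in M. f x = g x) \<longrightarrow> (AE x in M. S f x = S g x))"

definition linear_operator_on ::
  "'a measure \<Rightarrow> ('a \<Rightarrow> complex) set \<Rightarrow> (('a \<Rightarrow> complex) \<Rightarrow> 'a \<Rightarrow> complex) \<Rightarrow> bool" where
  "linear_operator_on M D S \<longleftrightarrow> operator_on M D S \<and>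
     (\<forall>f\<in>D. \<forall>g\<in>D. AE x in M. S (\<lambda>y. f y + g y) x = S f x + S g x) \<and>
     (\<forall>a. \<forall>f\<in>D. AE x in M. S (\<lambda>y. a * f y) x = a * S f x)"

text \<open>Off-diagonal estimates only involve \<open>S\<close> on functions supported in balls, and a linear
  map that vanishes on all such functions need not vanish on a larger domain. The following
  condition excludes this: \<open>S (trunc (ball z n) f)\<close> tends to \<open>S f\<close> in measure on balls. It
  is vacuous if the functions in \<open>D\<close> have bounded support, and it holds if \<open>S\<close> is continuous
  from some \<open>L\<^sup>p\<close> with finite \<open>p\<close> containing \<open>D\<close> to some \<open>L\<^sup>q\<close>.\<close>

definition determined_by_truncations ::
  "('a::metric_space) measure \<Rightarrow> ('a \<Rightarrow> complex) set \<Rightarrow> (('a \<Rightarrow> complex) \<Rightarrow> 'a \<Rightarrow> complex) \<Rightarrow> bool" where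
  "determined_by_truncations M D S \<longleftrightarrow>
     (\<forall>f\<in>D. \<forall>z. \<forall>R>0. \<forall>\<epsilon>>0.
        (\<lambda>n. measure M {x \<in> ball z R. \<epsilon> < norm (S (trunc (ball z (real n)) f) x - S f x)})
          \<longlonglongrightarrow> 0)"

definition off_diagonal_on_balls ::
  "('a::metric_space) measure \<Rightarrow> ennreal \<Rightarrow> ennreal \<Rightarrow> ('a \<Rightarrow> complex) set \<Rightarrow>
    (real \<Rightarrow> ('a \<Rightarrow> complex) \<Rightarrow> 'a \<Rightarrow> complex) \<Rightarrow> bool" where
  "off_diagonal_on_balls M p q D T \<longleftrightarrow>
     (\<exists>\<theta>1>0. \<exists>\<theta>2>0. \<exists>c>0. \<exists>C>0. \<forall>t>0. \<forall>x. \<forall>r>0. \<forall>f\<in>D.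
        avg_norm M q (ball x r) (ball x r) (T t (trunc (ball x r) f))
          \<le> ennreal (C * Upsilon (r / sqrt t) powr \<theta>2) * avg_norm M p (ball x r) (ball x r) f \<and>
        (\<forall>j\<ge>2.
          avg_norm M q (ball x r) (ball x r) (T t (trunc (annulus x r j) f))
            \<le> ennreal (C * 2 powr (real j * \<theta>1) * Upsilon (2 ^ j * r / sqrt t) powr \<theta>2
                  * exp (- (c * 4 ^ j * r\<^sup>2 / t)))
              * avg_norm M p (ball x (2 ^ (j + 1) * r)) (annulus x r j) f \<and>
          avg_norm M q (ball x (2 ^ (j + 1) * r)) (annulus x r j) (T t (trunc (ball x r) f))
            \<le> ennreal (C * 2 powr (real j * \<theta>1) * Upsilon (2 ^ j * r / sqrt t) powr \<theta>2
                  * exp (- (c * 4 ^ j * r\<^sup>2 / t)))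
              * avg_norm M p (ball x r) (ball x r) f))"

end

theory Submission
  imports Defs
begin

text \<open>
  From estimates to kernel. On a ball of radius of order \<open>sqrt t\<close>, splitting the input over the
  ball and its dyadic annuli turns the off-diagonal estimates into the pointwise domination of
  \<open>T t f\<close> by the integral of \<open>W (x, y) * norm (f y)\<close>, where \<open>W\<close> is a Gaussian centred at the
  first point of a countable \<open>sqrt t\<close>-net near \<open>x\<close>. For a fixed \<open>g\<close> in the domain, the function
  \<open>(A, B) \<mapsto> \<integral>\<^sub>A T t (\<chi>\<^sub>B g)\<close> is then dominated by the measure with density
  \<open>W (x, y) * norm (g y)\<close>; it extends from rectangles to the product \<open>\<sigma>\<close>-algebra by
  Caratheodory's theorem, and its Radon-Nikodym density divided by \<open>g\<close> is a kernel for all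
  elements of the domain that live on the support of \<open>g\<close>. Countably many \<open>g\<close> exhaust the
  supports of the whole domain, and the kernels are glued together.

  From kernel to estimates. Doubling compares \<open>\<mu>(B(x, sqrt t))\<close> with the measures of the balls
  in the estimates at the price of a power of \<open>Upsilon\<close>, and the distance between a ball and its
  \<open>j\<close>-th annulus gives the exponential decay.
\<close>

subsection \<open>Measures from dominated bimeasures\<close>

text \<open>The obstacle is null sets. A value \<open>T t f\<close> is known only outside a null set
  depending on \<open>f\<close>, so for fixed \<open>x\<close> the set function
  \<open>B \<mapsto> T t (trunc B g) x\<close> need not be a measure, and no density can be taken
  fibre by fibre. Integrating over \<open>A\<close> removes these null sets, at the price of having
  to pass from rectangles back to points at the end. The domain is a second obstacle. It need not be
  complete or contain a nowhere vanishing function, so a duality argument on all of L1 is not at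
  hand: only truncation and linear combinations stay inside it. The domination by a positive kernel
  takes the place of norm continuity. It gives countable additivity and all limits by dominated
  convergence in single fibres. For this the dominating kernel must be jointly measurable, and for
  each \<open>f\<close> the bound must hold off a single null set. A Gaussian centred at
  \<open>x\<close> itself would require uncountably many balls; centring at the points of a
  countable net requires only countably many and changes the constants alone.\<close>

locale dominated_bimeasure = sigma_finite_measure M
  for M :: "'a measure" +
  fixes v :: "'a set \<Rightarrow> 'a \<Rightarrow> real" and w :: "'a \<times> 'a \<Rightarrow> real"
  assumes v_measurable [measurable]: "\<And>B. B \<in> sets M \<Longrightarrow> v B \<in> borel_measurable M"
    and v_additive: "\<And>B C. B \<in> sets M \<Longrightarrow> C \<in> sets M \<Longrightarrow> B \<inter> C = {} \<Longrightarrow>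
      AE x in M. v (B \<union> C) x = v B x + v C x"
    and w_measurable [measurable]: "w \<in> borel_measurable (M \<Otimes>\<^sub>M M)"
    and w_nonneg: "\<And>z. 0 \<le> w z"
    and w_integrable: "\<And>x. x \<in> space M \<Longrightarrow> integrable M (\<lambda>y. w (x, y))"
    and v_nonneg: "\<And>B. B \<in> sets M \<Longrightarrow> AE x in M. 0 \<le> v B x"
    and v_le: "\<And>B. B \<in> sets M \<Longrightarrow> AE x in M. v B x \<le> (LINT y:B|M. w (x, y))"
begin

lemma w_set_integrable:
  "x \<in> space M \<Longrightarrow> B \<in> sets M \<Longrightarrow> set_integrable M B (\<lambda>y. w (x, y))"
  unfolding set_integrable_def using integrable_mult_indicator w_integrable by blast

lemma w_set_integral_measurable [measurable]:
  assumes "B \<in> sets M"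
  shows "(\<lambda>x. LINT y:B|M. w (x, y)) \<in> borel_measurable M"
  unfolding set_lebesgue_integral_def using assms by measurable

lemma v_empty: "AE x in M. v {} x = 0"
  using v_nonneg[of "{}"] v_le[of "{}"] by (auto simp: set_lebesgue_integral_def)

text \<open>Additivity holds outside a null set that depends on the sets involved. Keeping the
  remainder of \<open>B\<close> as an explicit term lets the identity be used along growing finite
  families, with the limit taken in the remainder.\<close>

lemma v_finite_Union:
  assumes "finite I" "\<And>i. i \<in> I \<Longrightarrow> C i \<in> sets M" "disjoint_family_on C I"
    and "B \<in> sets M" "\<And>i. i \<in> I \<Longrightarrow> C i \<subseteq> B"
  shows "AE x in M. v B x = (\<Sum>i\<in>I. v (C i) x) + v (B - (\<Union>i\<in>I. C i)) x"
  using assms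
proof (induction I)
  case empty
  then show ?case by simp
next
  case (insert i I)
  have sets: "(\<Union>j\<in>I. C j) \<in> sets M" "C i \<in> sets M"
    using insert.prems(1) insert.hyps(1) by auto
  have disj: "C i \<inter> (\<Union>j\<in>I. C j) = {}"
    using insert.prems(2) insert.hyps(2) by (fastforce simp: disjoint_family_on_def)
  have split: "B - (\<Union>j\<in>I. C j) = C i \<union> (B - (\<Union>j\<in>insert i I. C j))"
    using disj insert.prems(4)[of i] by auto
  have "AE x in M. v (B - (\<Union>j\<in>I. C j)) x = v (C i) x + v (B - (\<Union>j\<in>insert i I. C j)) x"
    unfolding split using sets insert.prems(3) by (intro v_additive) auto
  moreover have "AE x in M. v B x = (\<Sum>i\<in>I. v (C i) x) + v (B - (\<Union>i\<in>I. C i)) x"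
    using insert.prems
    by (intro insert.IH) (auto simp: disjoint_family_on_def)
  ultimately show ?case
    by eventually_elim (use insert.hyps in simp)
qed

text \<open>\<open>ennreal\<close> clips negative values of \<open>v B\<close> to 0; they occur on a
  null set only, so the content is not affected. The value may be infinite, as no integrability over
  \<open>A\<close> is assumed.\<close>

definition rect_content :: "'a set \<Rightarrow> 'a set \<Rightarrow> ennreal" where
  "rect_content A B = (\<integral>\<^sup>+x\<in>A. ennreal (v B x) \<partial>M)"

text \<open>Countable additivity on rectangles reduces to finite additivity of \<open>v\<close> in a single fibre
  because only countably many finite subfamilies of the \<open>B n\<close> can occur; the remainders tend
  to zero by domination.\<close>

lemma fibre_countably_additive:
  assumes A: "\<And>n::nat. A n \<in> sets M" "A' \<in> sets M" and B: "\<And>n. B n \<in> sets M" "B' \<in> sets M"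
    and disj: "disjoint_family (\<lambda>n. A n \<times> B n)" and un: "(\<Union>n. A n \<times> B n) = A' \<times> B'"
  shows "AE x in M. (\<Sum>n. ennreal (v (B n) x) * indicator (A n) x) = ennreal (v B' x) * indicator A' x"
proof -
  define R where "R I = B' - (\<Union>i\<in>I. B i)" for I
  have R: "R I \<in> sets M" if "finite I" for I
    unfolding R_def using that B by (intro sets.Diff sets.finite_UN) auto
  have fin: "AE x in M. \<forall>I\<in>{I. finite I}. disjoint_family_on B I \<and> (\<forall>i\<in>I. B i \<subseteq> B') \<longrightarrow>
      v B' x = (\<Sum>i\<in>I. v (B i) x) + v (R I) x"
  proof (rule AE_ball_countable')
    fix I :: "nat set"
    assume "I \<in> {I. finite I}"
    then show "AE x in M. disjoint_family_on B I \<and> (\<forall>i\<in>I. B i \<subseteq> B') \<longrightarrow>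
      v B' x = (\<Sum>i\<in>I. v (B i) x) + v (R I) x"
      unfolding R_def using v_finite_Union[of I B B'] B
      by (cases "disjoint_family_on B I \<and> (\<forall>i\<in>I. B i \<subseteq> B')") auto
  qed (rule countable_Collect_finite)
  have rem: "AE x in M. \<forall>I\<in>{I. finite I}. 0 \<le> v (R I) x \<and> v (R I) x \<le> (LINT y:R I|M. w (x, y))"
    using R v_nonneg v_le by (intro AE_ball_countable' countable_Collect_finite) auto
  have pos: "AE x in M. \<forall>n. 0 \<le> v (B n) x"
    using B v_nonneg by (simp add: AE_all_countable)
  show ?thesis
    using fin rem pos v_empty AE_space
  proof eventually_elim
    case (elim x)
    show ?case
    proof (cases "x \<in> A'")
      case False
      \<comment> \<open>Over a point outside \<open>A'\<close>, a rectangle with \<open>x\<close> in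
        \<open>A n\<close> must be empty. Its term is \<open>v {} x\<close>, which is 0 only almost
        everywhere.\<close>
      have "B n = {}" if "x \<in> A n" for n
        using that un False by blast
      then have "(\<lambda>n. ennreal (v (B n) x) * indicator (A n) x) = (\<lambda>n. 0)"
        using elim(4) by (auto simp: indicator_def fun_eq_iff)
      with False show ?thesis by simp
    next
      case True
      \<comment> \<open>Disjoint rectangles may have overlapping second sides. Those whose first
        side contains the given \<open>x\<close> do have disjoint second sides.\<close>
      define I where "I N = {n. n < N \<and> x \<in> A n}" for N
      have I: "finite (I N)" for N
        unfolding I_def by simp
      have sub: "B n \<subseteq> B'" if "x \<in> A n" for n
        using that un by blast
      have dj: "disjoint_family_on B (I N)" for N
        unfolding disjoint_family_on_def I_def
      proof safe
        fix m n y
        assume "x \<in> A m" "x \<in> A n" "m \<noteq> n" "y \<in> B m" "y \<in> B n"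
        then have "(x, y) \<in> (A m \<times> B m) \<inter> (A n \<times> B n)" by auto
        then show "y \<in> {}"
          using disj \<open>m \<noteq> n\<close> by (auto simp: disjoint_family_on_def)
      qed
      have "(\<lambda>N. LINT y:R (I N)|M. w (x, y)) \<longlonglongrightarrow> (LINT y:(\<Inter>N. R (I N))|M. w (x, y))"
      proof (rule set_integral_cont_down)
        show "R (I N) \<in> sets M" for N
          by (rule R[OF I])
        show "decseq (\<lambda>N. R (I N))"
          unfolding decseq_def R_def I_def by fastforce
        show "set_integrable M (R (I 0)) (\<lambda>y. w (x, y))"
          using R[OF I] elim(5) by (intro w_set_integrable)
      qed
      moreover have "(\<Inter>N. R (I N)) = {}"
      proof -
        have "\<exists>N. y \<notin> R (I N)" for y
        proof (cases "y \<in> B'")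
          case yB: True
          then obtain n where "x \<in> A n" "y \<in> B n"
            using un True by (metis (no_types, lifting) UN_E mem_Sigma_iff)
          then show ?thesis
            unfolding R_def I_def by (intro exI[of _ "Suc n"]) auto
        qed (auto simp: R_def)
        then show ?thesis by auto
      qed
      ultimately have lim0: "(\<lambda>N. LINT y:R (I N)|M. w (x, y)) \<longlonglongrightarrow> 0"
        by (simp add: set_lebesgue_integral_def)
      have "(\<lambda>N. v (R (I N)) x) \<longlonglongrightarrow> 0"
        using elim(2) I by (intro tendsto_sandwich[OF _ _ tendsto_const lim0]) auto
      then have "(\<lambda>N. v B' x - v (R (I N)) x) \<longlonglongrightarrow> v B' x - 0"
        by (intro tendsto_intros)
      moreover have "v B' x - v (R (I N)) x = (\<Sum>n<N. v (B n) x * indicator (A n) x)" for N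
      proof -
        have "\<forall>i\<in>I N. B i \<subseteq> B'"
          using sub by (auto simp: I_def)
        then have "v B' x = (\<Sum>i\<in>I N. v (B i) x) + v (R (I N)) x"
          using elim(1) I dj by blast
        moreover have "(\<Sum>i\<in>I N. v (B i) x) = (\<Sum>n<N. v (B n) x * indicator (A n) x)"
          unfolding I_def by (rule sum.mono_neutral_cong_left) (auto simp: indicator_def)
        ultimately show ?thesis by simp
      qed
      ultimately have "(\<lambda>n. v (B n) x * indicator (A n) x) sums v B' x"
        by (simp add: sums_def)
      then have "(\<Sum>n. ennreal (v (B n) x * indicator (A n) x)) = ennreal (v B' x)"
        using elim(3) by (intro suminf_ennreal_eq) auto
      moreover have "ennreal (v (B n) x * indicator (A n) x) = ennreal (v (B n) x) * indicator (A n) x" for n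
        by (simp add: indicator_def)
      ultimately show ?thesis
        using True by simp
    qed
  qed
qed

lemma rect_content_eq_0:
  assumes "A \<times> B = {}"
  shows "rect_content A B = 0"
proof -
  have "AE x in M. ennreal (v B x) * indicator A x = 0"
    using assms v_empty by auto
  then have "rect_content A B = (\<integral>\<^sup>+x. 0 \<partial>M)"
    unfolding rect_content_def by (intro nn_integral_cong_AE)
  then show ?thesis
    by simp
qed

lemma semiring_of_rectangles:
  "semiring_of_sets (space M \<times> space M) {A \<times> B | A B. A \<in> sets M \<and> B \<in> sets M}"
    (is "semiring_of_sets _ ?R")
proof
  show "?R \<subseteq> Pow (space M \<times> space M)"
    using sets.sets_into_space by fast
  show "{} \<in> ?R" by auto
next
  fix a b assume "a \<in> ?R" "b \<in> ?R"
  then obtain A B C D where ab: "a = A \<times> B" "b = C \<times> D" "A \<in> sets M" "B \<in> sets M" "C \<in> sets M" "D \<in> sets M"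
    by auto
  then show "a \<inter> b \<in> ?R"
    by (auto simp: Times_Int_Times)
  show "\<exists>C\<subseteq>?R. finite C \<and> disjoint C \<and> a - b = \<Union> C"
    using ab by (intro exI[of _ "{(A - C) \<times> B, (A \<inter> C) \<times> (B - D)}"])
      (auto simp: disjoint_def)
qed

lemma ex_rect_measure:
  "\<exists>N. sets N = sets (M \<Otimes>\<^sub>M M) \<and>
    (\<forall>A\<in>sets M. \<forall>B\<in>sets M. emeasure N (A \<times> B) = rect_content A B)"
proof -
  define N where "N = extend_measure (space M \<times> space M) {(A, B). A \<in> sets M \<and> B \<in> sets M}
    (\<lambda>(A, B). A \<times> B) (\<lambda>(A, B). rect_content A B)"
  have img: "(\<lambda>(A, B). A \<times> B) ` {(A, B). A \<in> sets M \<and> B \<in> sets M} =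
      {A \<times> B | A B. A \<in> sets M \<and> B \<in> sets M}"
    by auto
  have "(\<lambda>(A, B). A \<times> B) ` {(A, B). A \<in> sets M \<and> B \<in> sets M} \<subseteq> Pow (space M \<times> space M)"
    using sets.sets_into_space by fast
  then have "sets N = sigma_sets (space M \<times> space M) {A \<times> B | A B. A \<in> sets M \<and> B \<in> sets M}"
    unfolding N_def by (simp only: sets_extend_measure img)
  then have sets: "sets N = sets (M \<Otimes>\<^sub>M M)"
    by (simp add: sets_pair_measure)
  have "emeasure N (A \<times> B) = rect_content A B" if "A \<in> sets M" "B \<in> sets M" for A B
  proof (rule extend_measure_caratheodory_pair[OF N_def])
    show "A \<in> sets M \<and> B \<in> sets M" using that by simp
    show "semiring_of_sets (space M \<times> space M) {A \<times> B | A B. A \<in> sets M \<and> B \<in> sets M}"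
      by (rule semiring_of_rectangles)
    show "rect_content A B = 0" if "A \<times> B = {}" for A B
      using that by (rule rect_content_eq_0)
    \<comment> \<open>The content is a function of pairs, so it must be shown to depend on the
      rectangle only. Nonempty rectangles determine their sides; the empty ones have many
      representations, all of content 0.\<close>
    show "rect_content A B = rect_content C D" if "A \<times> B = C \<times> D" for A B C D
    proof (cases "A \<times> B = {}")
      case True
      then show ?thesis using that by (metis rect_content_eq_0)
    next
      case False
      then show ?thesis using that by (metis times_eq_iff Sigma_empty1 Sigma_empty2)
    qed
    show "(\<Sum>n. rect_content (A n) (B n)) = rect_content A' B'"
      if "\<And>n. A n \<in> sets M \<and> B n \<in> sets M" "A' \<in> sets M \<and> B' \<in> sets M"
        "disjoint_family (\<lambda>n. A n \<times> B n)" "(\<Union>n. A n \<times> B n) = A' \<times> B'"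
      for A B A' B'
    proof -
      have [measurable]: "A n \<in> sets M" "B n \<in> sets M" for n
        using that(1) by auto
      have "(\<Sum>n. rect_content (A n) (B n)) = (\<integral>\<^sup>+x. (\<Sum>n. ennreal (v (B n) x) * indicator (A n) x) \<partial>M)"
        unfolding rect_content_def by (intro nn_integral_suminf[symmetric]) measurable
      also have "\<dots> = (\<integral>\<^sup>+x. ennreal (v B' x) * indicator A' x \<partial>M)"
        using fibre_countably_additive[of A A' B B'] that by (intro nn_integral_cong_AE) auto
      finally show ?thesis unfolding rect_content_def .
    qed
  qed simp
  with sets show ?thesis by blast
qed

end

text \<open>Used to add the rectangle measures of \<open>v\<close> and of its complement; the sum is
  then compared with the measure of density \<open>w\<close>.\<close>

lemma ex_sum_measure:
  assumes "sets N = sets M"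
  shows "\<exists>L. sets L = sets M \<and> (\<forall>E\<in>sets M. emeasure L E = emeasure M E + emeasure N E)"
proof -
  define L where "L = measure_of (space M) (sets M) (\<lambda>E. emeasure M E + emeasure N E)"
  have "countably_additive (sets M) (\<lambda>E. emeasure M E + emeasure N E)"
  proof (rule countably_additiveI)
    fix A :: "nat \<Rightarrow> 'a set"
    assume A: "range A \<subseteq> sets M" "disjoint_family A"
    have "(\<Sum>i. emeasure M (A i) + emeasure N (A i)) = (\<Sum>i. emeasure M (A i)) + (\<Sum>i. emeasure N (A i))"
      by (intro suminf_add[symmetric]) auto
    then show "(\<Sum>i. emeasure M (A i) + emeasure N (A i)) = emeasure M (\<Union>i. A i) + emeasure N (\<Union>i. A i)"
      using A assms by (simp add: suminf_emeasure)
  qed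
  then have "emeasure L E = emeasure M E + emeasure N E" if "E \<in> sets M" for E
    unfolding L_def using that
    by (intro emeasure_measure_of_sigma sets.sigma_algebra_axioms) (auto simp: positive_def)
  moreover have "sets L = sets M"
    unfolding L_def by simp
  ultimately show ?thesis by blast
qed

text \<open>Tonelli's theorem, with a Bochner integral inside because \<open>w\<close> is integrable
  in every fibre. A general \<open>w\<close> is allowed since the formula serves both the dominating
  density and the density found in the end.\<close>

lemma (in sigma_finite_measure) emeasure_density_rectangle:
  fixes w :: "'a \<times> 'a \<Rightarrow> real"
  assumes [measurable]: "w \<in> borel_measurable (M \<Otimes>\<^sub>M M)" and w_nonneg: "\<And>z. 0 \<le> w z"
    and w_integrable: "\<And>x. x \<in> space M \<Longrightarrow> integrable M (\<lambda>y. w (x, y))"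
    and [measurable]: "A \<in> sets M" and B [measurable]: "B \<in> sets M"
  shows "emeasure (density (M \<Otimes>\<^sub>M M) w) (A \<times> B) = (\<integral>\<^sup>+x\<in>A. ennreal (LINT y:B|M. w (x, y)) \<partial>M)"
proof -
  interpret MM: pair_sigma_finite M M ..
  have "emeasure (density (M \<Otimes>\<^sub>M M) w) (A \<times> B) =
      (\<integral>\<^sup>+z. ennreal (w z) * indicator (A \<times> B) z \<partial>(M \<Otimes>\<^sub>M M))"
    by (intro emeasure_density) auto
  also have "\<dots> = (\<integral>\<^sup>+x. (\<integral>\<^sup>+y. ennreal (w (x, y)) * indicator (A \<times> B) (x, y) \<partial>M) \<partial>M)"
    by (subst nn_integral_fst[symmetric]) auto
  also have "\<dots> = (\<integral>\<^sup>+x\<in>A. ennreal (LINT y:B|M. w (x, y)) \<partial>M)"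
  proof (intro nn_integral_cong)
    fix x assume x: "x \<in> space M"
    have "(\<integral>\<^sup>+y. ennreal (w (x, y)) * indicator (A \<times> B) (x, y) \<partial>M) =
        (\<integral>\<^sup>+y. ennreal (indicator B y *\<^sub>R w (x, y)) * indicator A x \<partial>M)"
      by (intro nn_integral_cong) (auto simp: indicator_def)
    also have "\<dots> = (\<integral>\<^sup>+y. ennreal (indicator B y *\<^sub>R w (x, y)) \<partial>M) * indicator A x"
      using x by (intro nn_integral_multc) measurable
    also have "(\<integral>\<^sup>+y. ennreal (indicator B y *\<^sub>R w (x, y)) \<partial>M) = ennreal (LINT y:B|M. w (x, y))"
      unfolding set_lebesgue_integral_def
      using integrable_mult_indicator[OF B w_integrable[OF x]] w_nonneg
      by (intro nn_integral_eq_integral) auto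
    finally show "(\<integral>\<^sup>+y. ennreal (w (x, y)) * indicator (A \<times> B) (x, y) \<partial>M) =
      ennreal (LINT y:B|M. w (x, y)) * indicator A x" .
  qed
  finally show ?thesis .
qed

section \<open>Radon-Nikodym density of a dominated bimeasure\<close>

context dominated_bimeasure
begin

sublocale MM: pair_sigma_finite M M ..

text \<open>An inequality between measures on rectangles does not pass to the generated \<open>\<sigma>\<close>-algebra by a
  Dynkin argument, but an equality does: \<open>v\<close> and its complement add up to \<open>w\<close>, which yields
  the domination of both.\<close>

lemma complement: "dominated_bimeasure M (\<lambda>B x. (LINT y:B|M. w (x, y)) - v B x) w"
proof
  show "(\<lambda>x. (LINT y:B|M. w (x, y)) - v B x) \<in> borel_measurable M" if [measurable]: "B \<in> sets M" for B
    by measurable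
  show "AE x in M. (LINT y:B \<union> C|M. w (x, y)) - v (B \<union> C) x =
      (LINT y:B|M. w (x, y)) - v B x + ((LINT y:C|M. w (x, y)) - v C x)"
    if BC: "B \<in> sets M" "C \<in> sets M" "B \<inter> C = {}" for B C
    using v_additive[OF BC] AE_space
  proof eventually_elim
    case (elim x)
    have "(LINT y:B \<union> C|M. w (x, y)) = (LINT y:B|M. w (x, y)) + (LINT y:C|M. w (x, y))"
      using BC elim(2) by (intro set_integral_Un w_set_integrable)
    with elim(1) show ?case by simp
  qed
  show "AE x in M. 0 \<le> (LINT y:B|M. w (x, y)) - v B x" if "B \<in> sets M" for B
    using v_le[OF that] by eventually_elim simp
  show "AE x in M. (LINT y:B|M. w (x, y)) - v B x \<le> (LINT y:B|M. w (x, y))" if "B \<in> sets M" for B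
    using v_nonneg[OF that] by eventually_elim simp
qed (use w_nonneg w_integrable in auto)

lemma emeasure_density_w:
  assumes "A \<in> sets M" "B \<in> sets M"
  shows "emeasure (density (M \<Otimes>\<^sub>M M) w) (A \<times> B) = (\<integral>\<^sup>+x\<in>A. ennreal (LINT y:B|M. w (x, y)) \<partial>M)"
  using assms w_nonneg w_integrable by (intro emeasure_density_rectangle) auto

text \<open>Uniqueness of measures on a generator needs an exhaustion by rectangles of finite mass.
  Integrability of \<open>w\<close> in each fibre does not make it integrable over the product, so
  \<open>X n\<close> is cut out of a set of finite measure by bounding the fibre integral by
  \<open>n\<close>.\<close>

lemma rect_finite_cover:
  obtains X :: "nat \<Rightarrow> 'a set" where "range X \<subseteq> sets M" "(\<Union>n. X n) = space M"
    "\<And>n. emeasure (density (M \<Otimes>\<^sub>M M) w) (X n \<times> space M) \<noteq> \<infinity>"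
proof -
  obtain S :: "nat \<Rightarrow> 'a set" where S: "range S \<subseteq> sets M" "(\<Union>i. S i) = space M"
      "\<And>i. emeasure M (S i) \<noteq> \<infinity>" "incseq S"
    using sigma_finite_incseq by blast
  define X where "X n = {x \<in> S n. (LINT y:space M|M. w (x, y)) \<le> real n}" for n
  have S_sets [measurable]: "S n \<in> sets M" for n
    using S(1) by auto
  have "X n = S n \<inter> {x \<in> space M. (LINT y:space M|M. w (x, y)) \<le> real n}" for n
    using sets.sets_into_space[OF S_sets, of n] unfolding X_def by auto
  moreover have "S n \<inter> {x \<in> space M. (LINT y:space M|M. w (x, y)) \<le> real n} \<in> sets M" for n
    by (intro sets.Int S_sets) measurable
  ultimately have X [measurable]: "X n \<in> sets M" for n
    by (simp add: X_def)
  have "(\<Union>n. X n) = space M"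
  proof
    show "(\<Union>n. X n) \<subseteq> space M"
      using S(2) by (auto simp: X_def)
    show "space M \<subseteq> (\<Union>n. X n)"
    proof
      fix x assume "x \<in> space M"
      then obtain i where i: "x \<in> S i" using S(2) by auto
      obtain k :: nat where k: "(LINT y:space M|M. w (x, y)) \<le> real k"
        using real_arch_simple by blast
      have "x \<in> S (max i k)"
        using i S(4) by (meson incseqD max.cobounded1 subsetD)
      then have "x \<in> X (max i k)"
        using k unfolding X_def by auto
      then show "x \<in> (\<Union>n. X n)" by blast
    qed
  qed
  moreover have "emeasure (density (M \<Otimes>\<^sub>M M) w) (X n \<times> space M) \<noteq> \<infinity>" for n
  proof -
    have "emeasure (density (M \<Otimes>\<^sub>M M) w) (X n \<times> space M) =
        (\<integral>\<^sup>+x\<in>X n. ennreal (LINT y:space M|M. w (x, y)) \<partial>M)"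
      by (rule emeasure_density_w) auto
    also have "\<dots> \<le> (\<integral>\<^sup>+x. ennreal (real n) * indicator (S n) x \<partial>M)"
      by (intro nn_integral_mono) (auto simp: X_def indicator_def intro!: ennreal_leI)
    also have "\<dots> = ennreal (real n) * emeasure M (S n)"
      by (simp add: nn_integral_cmult_indicator)
    also have "\<dots> < \<infinity>"
      using S(3)[of n] by (simp add: ennreal_mult_less_top less_top)
    finally show ?thesis by simp
  qed
  ultimately show thesis
    using X by (intro that[of X]) auto
qed

text \<open>The bound on \<open>k\<close> holds at every point, the identity only almost everywhere
  for each \<open>B\<close>: the former is repaired on a null set of the product, the latter is
  recovered from the masses of rectangles with \<open>B\<close> fixed.\<close>

lemma ex_density:
  "\<exists>k\<in>borel_measurable (M \<Otimes>\<^sub>M M). (\<forall>z. 0 \<le> k z \<and> k z \<le> w z) \<and>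
     (\<forall>B\<in>sets M. AE x in M. v B x = (LINT y:B|M. k (x, y)))"
proof -
  interpret c: dominated_bimeasure M "\<lambda>B x. (LINT y:B|M. w (x, y)) - v B x" w
    by (rule complement)
  obtain N where N: "sets N = sets (M \<Otimes>\<^sub>M M)"
      "\<And>A B. A \<in> sets M \<Longrightarrow> B \<in> sets M \<Longrightarrow> emeasure N (A \<times> B) = rect_content A B"
    using ex_rect_measure by blast
  obtain N' where N': "sets N' = sets (M \<Otimes>\<^sub>M M)"
      "\<And>A B. A \<in> sets M \<Longrightarrow> B \<in> sets M \<Longrightarrow> emeasure N' (A \<times> B) = c.rect_content A B"
    using c.ex_rect_measure by blast
  have "sets N' = sets N"
    using N(1) N'(1) by simp
  from ex_sum_measure[OF this] obtain L where L: "sets L = sets N"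
      "\<And>E. E \<in> sets N \<Longrightarrow> emeasure L E = emeasure N E + emeasure N' E"
    by blast
  define W where "W = density (M \<Otimes>\<^sub>M M) w"
  obtain X :: "nat \<Rightarrow> 'a set" where X: "range X \<subseteq> sets M" "(\<Union>n. X n) = space M"
    "\<And>n. emeasure W (X n \<times> space M) \<noteq> \<infinity>"
    using rect_finite_cover[folded W_def] by metis
  have "W = L"
  proof (rule measure_eqI_generator_eq)
    let ?E = "{A \<times> B | A B. A \<in> sets M \<and> B \<in> sets M}"
    show "Int_stable ?E"
      by (rule Int_stable_pair_measure_generator)
    show "?E \<subseteq> Pow (space M \<times> space M)"
      using sets.sets_into_space by fast
    show "sets W = sigma_sets (space M \<times> space M) ?E" "sets L = sigma_sets (space M \<times> space M) ?E"
      unfolding W_def using L N by (simp_all add: sets_pair_measure)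
    show "range (\<lambda>n. X n \<times> space M) \<subseteq> ?E" "(\<Union>n. X n \<times> space M) = space M \<times> space M"
      using X by auto
    show "emeasure W (X n \<times> space M) \<noteq> \<infinity>" for n by (rule X)
    fix E assume "E \<in> ?E"
    then obtain A B where E: "E = A \<times> B" and [measurable]: "A \<in> sets M" "B \<in> sets M" by auto
    have "emeasure L E = rect_content A B + c.rect_content A B"
      using L N N' by (simp add: E)
    also have "\<dots> = (\<integral>\<^sup>+x. ennreal (v B x) * indicator A x +
        ennreal ((LINT y:B|M. w (x, y)) - v B x) * indicator A x \<partial>M)"
      unfolding rect_content_def c.rect_content_def by (intro nn_integral_add[symmetric]) measurable
    also have "\<dots> = (\<integral>\<^sup>+x\<in>A. ennreal (LINT y:B|M. w (x, y)) \<partial>M)"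
    proof (rule nn_integral_cong_AE)
      show "AE x in M. ennreal (v B x) * indicator A x + ennreal ((LINT y:B|M. w (x, y)) - v B x) * indicator A x
          = ennreal (LINT y:B|M. w (x, y)) * indicator A x"
        using v_nonneg[OF \<open>B \<in> sets M\<close>] v_le[OF \<open>B \<in> sets M\<close>]
      proof eventually_elim
        case (elim x)
        then show ?case
          by (auto simp: indicator_def ennreal_plus[symmetric] simp del: ennreal_plus)
      qed
    qed
    also have "\<dots> = emeasure W E"
      unfolding W_def E by (rule emeasure_density_w[symmetric]) auto
    finally show "emeasure W E = emeasure L E" by simp
  qed
  \<comment> \<open>A null set of the product is null for the density measure \<open>W\<close>,
    hence for \<open>L\<close>, which is the sum of \<open>N\<close> and \<open>N'\<close>, hence
    for each summand.\<close>
  have ac: "absolutely_continuous (M \<Otimes>\<^sub>M M) N \<and> absolutely_continuous (M \<Otimes>\<^sub>M M) N'"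
  proof -
    have "E \<in> null_sets N \<and> E \<in> null_sets N'" if "E \<in> null_sets (M \<Otimes>\<^sub>M M)" for E
    proof -
      have "E \<in> null_sets W"
        using absolutely_continuousI_density[of w "M \<Otimes>\<^sub>M M"] that
        by (auto simp: W_def absolutely_continuous_def)
      then have "emeasure L E = 0"
        by (simp add: \<open>W = L\<close> null_sets_def)
      moreover have "E \<in> sets N"
        using that N by auto
      ultimately show ?thesis
        using L N N' by (auto simp: null_sets_def)
    qed
    then show ?thesis
      by (auto simp: absolutely_continuous_def)
  qed
  obtain k where k [measurable]: "k \<in> borel_measurable (M \<Otimes>\<^sub>M M)" and Nk: "density (M \<Otimes>\<^sub>M M) k = N"
    using MM.P.Radon_Nikodym ac N(1) by blast
  obtain k' where k' [measurable]: "k' \<in> borel_measurable (M \<Otimes>\<^sub>M M)" and Nk': "density (M \<Otimes>\<^sub>M M) k' = N'"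
    using MM.P.Radon_Nikodym ac N'(1) by blast
  have "density (M \<Otimes>\<^sub>M M) (\<lambda>z. k z + k' z) = W"
  proof (rule measure_eqI)
    show "sets (density (M \<Otimes>\<^sub>M M) (\<lambda>z. k z + k' z)) = sets W"
      by (simp add: W_def)
    fix E assume "E \<in> sets (density (M \<Otimes>\<^sub>M M) (\<lambda>z. k z + k' z))"
    then have [measurable]: "E \<in> sets (M \<Otimes>\<^sub>M M)" by simp
    have "emeasure (density (M \<Otimes>\<^sub>M M) (\<lambda>z. k z + k' z)) E =
        (\<integral>\<^sup>+z. k z * indicator E z + k' z * indicator E z \<partial>(M \<Otimes>\<^sub>M M))"
      by (simp add: emeasure_density distrib_right)
    also have "\<dots> = emeasure N E + emeasure N' E"
      unfolding Nk[symmetric] Nk'[symmetric] by (simp add: emeasure_density nn_integral_add)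
    also have "\<dots> = emeasure W E"
      using L N by (simp add: \<open>W = L\<close>)
    finally show "emeasure (density (M \<Otimes>\<^sub>M M) (\<lambda>z. k z + k' z)) E = emeasure W E" .
  qed
  then have "AE z in M \<Otimes>\<^sub>M M. k z + k' z = ennreal (w z)"
    unfolding W_def by (intro MM.P.density_unique) auto
  then have "AE z in M \<Otimes>\<^sub>M M. k z \<le> ennreal (w z)"
    by eventually_elim (metis add_increasing2 order_refl zero_le)
  \<comment> \<open>Capping by \<open>w\<close> changes \<open>k\<close> on a null set only. The
    bound then holds everywhere, so that \<open>h\<close> is real valued and integrable in every
    fibre.\<close>
  define h where "h z = enn2real (min (k z) (ennreal (w z)))" for z
  have [measurable]: "h \<in> borel_measurable (M \<Otimes>\<^sub>M M)"
    unfolding h_def by measurable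
  have h_ennreal: "ennreal (h z) = min (k z) (ennreal (w z))" for z
    unfolding h_def by (intro ennreal_enn2real) (auto simp: min_less_iff_disj)
  have h: "0 \<le> h z" "h z \<le> w z" for z
    unfolding h_def using w_nonneg[of z] by (auto intro!: enn2real_leI)
  have "AE z in M \<Otimes>\<^sub>M M. k z = ennreal (h z)"
    using \<open>AE z in M \<Otimes>\<^sub>M M. k z \<le> ennreal (w z)\<close>
    by eventually_elim (simp add: h_ennreal min_def)
  then have Nh: "density (M \<Otimes>\<^sub>M M) h = N"
    unfolding Nk[symmetric] by (intro density_cong) (auto elim!: eventually_mono)
  have h_integrable: "integrable M (\<lambda>y. h (x, y))" if "x \<in> space M" for x
  proof (rule Bochner_Integration.integrable_bound[OF w_integrable[OF that]])
    show "(\<lambda>y. h (x, y)) \<in> borel_measurable M"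
      using that by measurable
    show "AE y in M. norm (h (x, y)) \<le> norm (w (x, y))"
      using h(1) by (intro AE_I2) (use h(2) in \<open>fastforce intro: order_trans\<close>)
  qed
  have "AE x in M. v B x = (LINT y:B|M. h (x, y))" if [measurable]: "B \<in> sets M" for B
  proof -
    \<comment> \<open>With \<open>B\<close> fixed, both functions of \<open>x\<close> have the mass
      of \<open>A \<times> B\<close> as integral over every \<open>A\<close>; uniqueness of
      densities turns this into equality almost everywhere.\<close>
    have "density M (\<lambda>x. ennreal (v B x)) = density M (\<lambda>x. ennreal (LINT y:B|M. h (x, y)))"
    proof (rule measure_eqI)
      fix A assume "A \<in> sets (density M (\<lambda>x. ennreal (v B x)))"
      then have [measurable]: "A \<in> sets M" by simp
      have "emeasure (density M (\<lambda>x. ennreal (v B x))) A = emeasure N (A \<times> B)"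
        by (simp add: emeasure_density N rect_content_def)
      also have "\<dots> = (\<integral>\<^sup>+x\<in>A. ennreal (LINT y:B|M. h (x, y)) \<partial>M)"
        unfolding Nh[symmetric] using h h_integrable by (intro emeasure_density_rectangle) auto
      finally show "emeasure (density M (\<lambda>x. ennreal (v B x))) A =
          emeasure (density M (\<lambda>x. ennreal (LINT y:B|M. h (x, y)))) A"
        by (simp add: emeasure_density set_lebesgue_integral_def)
    qed simp
    then have "AE x in M. ennreal (v B x) = ennreal (LINT y:B|M. h (x, y))"
      by (intro density_unique) (auto simp: set_lebesgue_integral_def)
    with v_nonneg[OF that] show ?thesis
    proof eventually_elim
      case (elim x)
      have "0 \<le> (LINT y:B|M. h (x, y))"
        unfolding set_lebesgue_integral_def using h by simp
      with elim show ?case by simp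
    qed
  qed
  then show ?thesis
    using h by (intro bexI[of _ h]) auto
qed

end

subsection \<open>Kernels of dominated operators\<close>

text \<open>A shift reduces to the nonnegative case: adding the integral of \<open>w\<close> to
  \<open>u B\<close> gives a value between 0 and the integral of \<open>2 * w\<close>. Subtracting
  \<open>w\<close> from a density between 0 and \<open>2 * w\<close> returns the bound by
  \<open>w\<close> without loss.\<close>

lemma (in sigma_finite_measure) ex_signed_density:
  fixes u :: "'a set \<Rightarrow> 'a \<Rightarrow> real" and w :: "'a \<times> 'a \<Rightarrow> real"
  assumes u [measurable]: "\<And>B. B \<in> sets M \<Longrightarrow> u B \<in> borel_measurable M"
    and additive: "\<And>B C. B \<in> sets M \<Longrightarrow> C \<in> sets M \<Longrightarrow> B \<inter> C = {} \<Longrightarrow>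
      AE x in M. u (B \<union> C) x = u B x + u C x"
    and w [measurable]: "w \<in> borel_measurable (M \<Otimes>\<^sub>M M)"
    and w_nonneg: "\<And>z. 0 \<le> w z"
    and w_integrable: "\<And>x. x \<in> space M \<Longrightarrow> integrable M (\<lambda>y. w (x, y))"
    and bound: "\<And>B. B \<in> sets M \<Longrightarrow> AE x in M. \<bar>u B x\<bar> \<le> (LINT y:B|M. w (x, y))"
  shows "\<exists>k\<in>borel_measurable (M \<Otimes>\<^sub>M M). (\<forall>z. \<bar>k z\<bar> \<le> w z) \<and>
     (\<forall>B\<in>sets M. AE x in M. u B x = (LINT y:B|M. k (x, y)))"
proof -
  have w_set: "set_integrable M B (\<lambda>y. w (x, y))" if "x \<in> space M" "B \<in> sets M" for x B
    unfolding set_integrable_def using that integrable_mult_indicator w_integrable by blast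
  interpret dominated_bimeasure M "\<lambda>B x. u B x + (LINT y:B|M. w (x, y))" "\<lambda>z. 2 * w z"
  proof
    show "(\<lambda>x. u B x + (LINT y:B|M. w (x, y))) \<in> borel_measurable M" if "B \<in> sets M" for B
      unfolding set_lebesgue_integral_def using that by measurable
    show "AE x in M. u (B \<union> C) x + (LINT y:B \<union> C|M. w (x, y)) =
        u B x + (LINT y:B|M. w (x, y)) + (u C x + (LINT y:C|M. w (x, y)))"
      if BC: "B \<in> sets M" "C \<in> sets M" "B \<inter> C = {}" for B C
      using additive[OF BC] AE_space
    proof eventually_elim
      case (elim x)
      have "(LINT y:B \<union> C|M. w (x, y)) = (LINT y:B|M. w (x, y)) + (LINT y:C|M. w (x, y))"
        using BC elim(2) by (intro set_integral_Un w_set)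
      with elim(1) show ?case by simp
    qed
    show "AE x in M. 0 \<le> u B x + (LINT y:B|M. w (x, y))" if "B \<in> sets M" for B
      using bound[OF that] by eventually_elim simp
    show "AE x in M. u B x + (LINT y:B|M. w (x, y)) \<le> (LINT y:B|M. 2 * w (x, y))" if "B \<in> sets M" for B
      using bound[OF that] by eventually_elim simp
  qed (use w_nonneg w_integrable in auto)
  obtain k where [measurable]: "k \<in> borel_measurable (M \<Otimes>\<^sub>M M)" and k: "\<And>z. 0 \<le> k z" "\<And>z. k z \<le> 2 * w z"
    "\<And>B. B \<in> sets M \<Longrightarrow> AE x in M. u B x + (LINT y:B|M. w (x, y)) = (LINT y:B|M. k (x, y))"
    using ex_density by blast
  have "\<bar>k z - w z\<bar> \<le> w z" for z
    using k(1)[of z] k(2)[of z] by linarith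
  moreover have "AE x in M. u B x = (LINT y:B|M. k (x, y) - w (x, y))" if B: "B \<in> sets M" for B
    using k(3)[OF B] AE_space
  proof eventually_elim
    case (elim x)
    have "integrable M (\<lambda>y. k (x, y))"
    proof (rule Bochner_Integration.integrable_bound[of M "\<lambda>y. 2 * w (x, y)"])
      show "AE y in M. norm (k (x, y)) \<le> norm (2 * w (x, y))"
        using k(1) k(2) by (intro AE_I2) (fastforce intro: order_trans)
    qed (use elim(2) w_integrable in auto)
    then have "set_integrable M B (\<lambda>y. k (x, y))"
      unfolding set_integrable_def using B integrable_mult_indicator by blast
    then have "(LINT y:B|M. k (x, y) - w (x, y)) = (LINT y:B|M. k (x, y)) - (LINT y:B|M. w (x, y))"
      using w_set elim(2) B by (intro set_integral_diff) auto
    with elim(1) show ?case by simp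
  qed
  ultimately show ?thesis
    by (intro bexI[of _ "\<lambda>z. k z - w z"]) auto
qed

text \<open>The null set in the domination may depend on \<open>f\<close>. Boundedness of
  \<open>W\<close> in its second variable, without uniformity in \<open>x\<close>, is enough for
  \<open>W (x, y) * norm (f y)\<close> to be integrable in \<open>y\<close> for every integrable
  \<open>f\<close>.\<close>

locale dominated_operator = sigma_finite_measure M
  for M :: "'a measure" +
  fixes D :: "('a \<Rightarrow> complex) set" and S :: "('a \<Rightarrow> complex) \<Rightarrow> 'a \<Rightarrow> complex"
    and W :: "'a \<times> 'a \<Rightarrow> real"
  assumes D_integrable: "f \<in> D \<Longrightarrow> integrable M f"
    and D_stable: "truncation_stable_subspace M D"
    and S_linear: "linear_operator_on M D S"
    and W_measurable [measurable]: "W \<in> borel_measurable (M \<Otimes>\<^sub>M M)"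
    and W_nonneg: "0 \<le> W z"
    and W_bounded: "\<exists>b. \<forall>y. W (x, y) \<le> b"
    and dominated: "f \<in> D \<Longrightarrow> AE x in M. norm (S f x) \<le> (LINT y|M. W (x, y) * norm (f y))"
begin

lemma D_measurable [measurable_dest]: "f \<in> D \<Longrightarrow> f \<in> borel_measurable M"
  using D_integrable by auto

lemma D_closed:
  shows "(\<lambda>x. 0) \<in> D"
    and D_add: "f \<in> D \<Longrightarrow> g \<in> D \<Longrightarrow> (\<lambda>x. f x + g x) \<in> D"
    and D_cmult: "f \<in> D \<Longrightarrow> (\<lambda>x. a * f x) \<in> D"
    and D_trunc: "A \<in> sets M \<Longrightarrow> f \<in> D \<Longrightarrow> trunc A f \<in> D"
  using D_stable unfolding truncation_stable_subspace_def by auto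

lemma D_diff: "f \<in> D \<Longrightarrow> g \<in> D \<Longrightarrow> (\<lambda>x. f x - g x) \<in> D"
  using D_add[OF _ D_cmult[of g "-1"]] by simp

lemma S_measurable [measurable]: "f \<in> D \<Longrightarrow> S f \<in> borel_measurable M"
  using S_linear unfolding linear_operator_on_def operator_on_def by auto

lemma S_add: "f \<in> D \<Longrightarrow> g \<in> D \<Longrightarrow> AE x in M. S (\<lambda>y. f y + g y) x = S f x + S g x"
  using S_linear unfolding linear_operator_on_def by auto

lemma S_cmult: "f \<in> D \<Longrightarrow> AE x in M. S (\<lambda>y. a * f y) x = a * S f x"
  using S_linear unfolding linear_operator_on_def by auto

text \<open>The value type and the constant \<open>c\<close> are left free so that the lemma covers
  the real weight \<open>W\<close>, complex kernels bounded by \<open>2 * W\<close>, and the norms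
  of such kernels.\<close>

lemma kernel_integrable:
  fixes K :: "'a \<times> 'a \<Rightarrow> 'b::{real_normed_field, banach, second_countable_topology}"
  assumes [measurable]: "K \<in> borel_measurable (M \<Otimes>\<^sub>M M)" and K: "\<And>z. norm (K z) \<le> c * W z"
    and f: "integrable M f" and x: "x \<in> space M"
  shows "integrable M (\<lambda>y. K (x, y) * f y)"
proof -
  obtain b where b: "\<And>y. W (x, y) \<le> b" using W_bounded by blast
  have "norm (K (x, y)) \<le> \<bar>c\<bar> * b" for y
  proof -
    have "norm (K (x, y)) \<le> c * W (x, y)" by (rule K)
    also have "\<dots> \<le> \<bar>c\<bar> * W (x, y)" using W_nonneg by (intro mult_right_mono) auto
    also have "\<dots> \<le> \<bar>c\<bar> * b" using b by (intro mult_left_mono) auto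
    finally show ?thesis .
  qed
  moreover define B where "B = \<bar>c\<bar> * b"
  ultimately have B: "norm (K (x, y)) \<le> B" for y
    by simp
  then have "0 \<le> B"
    using norm_ge_zero order_trans by blast
  then have le: "norm (K (x, y) * f y) \<le> norm (B * norm (f y))" for y
    unfolding norm_mult using B by (auto intro!: mult_right_mono)
  show ?thesis
  proof (rule Bochner_Integration.integrable_bound[of M "\<lambda>y. B * norm (f y)"])
    show "(\<lambda>y. K (x, y) * f y) \<in> borel_measurable M"
      using f x by measurable
  qed (use f le in auto)
qed

text \<open>The exceptional null set depends on \<open>f\<close>. Hence the property is transported
  only by algebraic operations and by sequences, each of which involves countably many null
  sets.\<close>

definition represents :: "('a \<times> 'a \<Rightarrow> complex) \<Rightarrow> ('a \<Rightarrow> complex) \<Rightarrow> bool" where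
  "represents K f \<longleftrightarrow> (AE x in M. S f x = (LINT y|M. K (x, y) * f y))"

context
  fixes K :: "'a \<times> 'a \<Rightarrow> complex"
  assumes K_measurable [measurable]: "K \<in> borel_measurable (M \<Otimes>\<^sub>M M)"
    and K_bound: "\<And>z. norm (K z) \<le> 2 * W z"
begin

lemma represents_add:
  assumes "f \<in> D" "g \<in> D" "represents K f" "represents K g"
  shows "represents K (\<lambda>y. f y + g y)"
  unfolding represents_def
  using assms(3,4)[unfolded represents_def] S_add[OF assms(1,2)] AE_space
proof eventually_elim
  case (elim x)
  have "integrable M (\<lambda>y. K (x, y) * f y)" "integrable M (\<lambda>y. K (x, y) * g y)"
    using assms D_integrable elim(4) by (auto intro!: kernel_integrable[OF K_measurable K_bound])
  with elim show ?case
    by (simp add: distrib_left)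
qed

lemma represents_cmult:
  assumes "f \<in> D" "represents K f"
  shows "represents K (\<lambda>y. a * f y)"
  unfolding represents_def
  using assms(2)[unfolded represents_def] S_cmult[OF assms(1), of a]
  by eventually_elim (simp add: mult.left_commute)

lemma represents_zero: "represents K (\<lambda>y. 0)"
  unfolding represents_def using dominated[OF D_closed(1)] by eventually_elim simp

lemma represents_sum:
  assumes "finite I" "\<And>i. i \<in> I \<Longrightarrow> f i \<in> D" "\<And>i. i \<in> I \<Longrightarrow> represents K (f i)"
  shows "(\<lambda>y. \<Sum>i\<in>I. f i y) \<in> D \<and> represents K (\<lambda>y. \<Sum>i\<in>I. f i y)"
  using assms
proof (induction I)
  case empty
  then show ?case by (simp add: D_closed represents_zero)
next
  case (insert i I)
  then show ?case
    using D_add[of "f i" "\<lambda>y. \<Sum>i\<in>I. f i y"] represents_add[of "f i" "\<lambda>y. \<Sum>i\<in>I. f i y"]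
    by simp
qed

text \<open>By domination, \<open>S f x\<close> and \<open>S (F n) x\<close> differ by at most the
  integral of \<open>W (x, y) * norm (f y - F n y)\<close>, which tends to 0 in each fibre. The
  factor 2 is the one that comes with approximation by simple functions; it leads to the majorant
  with \<open>3 * norm (f y)\<close>.\<close>

lemma represents_limit:
  assumes F: "\<And>n. F n \<in> D" "\<And>n. represents K (F n)" and f: "f \<in> D"
    and lim: "AE y in M. (\<lambda>n. F n y) \<longlonglongrightarrow> f y"
    and le: "\<And>n y. y \<in> space M \<Longrightarrow> norm (F n y) \<le> 2 * norm (f y)"
  shows "represents K f"
proof -
  \<comment> \<open>Linearity is available for sums, so \<open>f\<close> is written as a difference
    plus \<open>F n\<close>; the argument on the left simplifies back to \<open>f\<close>.\<close>
  have "AE x in M. \<forall>n. S (\<lambda>y. (f y - F n y) + F n y) x = S (\<lambda>y. f y - F n y) x + S (F n) x"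
    using F f by (subst AE_all_countable) (intro allI S_add D_diff)
  moreover have "AE x in M. \<forall>n. norm (S (\<lambda>y. f y - F n y) x) \<le> (LINT y|M. W (x, y) * norm (f y - F n y))"
    using F f by (subst AE_all_countable) (intro allI dominated D_diff)
  moreover have "AE x in M. \<forall>n. S (F n) x = (LINT y|M. K (x, y) * F n y)"
    using F by (subst AE_all_countable) (simp add: represents_def)
  ultimately show ?thesis
    unfolding represents_def using AE_space
  proof eventually_elim
    case (elim x)
    have [measurable]: "f \<in> borel_measurable M" "F n \<in> borel_measurable M" for n
      using F f D_measurable by auto
    note x = elim(4)
    have fi: "integrable M (\<lambda>y. norm (f y))"
      using f D_integrable by auto
    have "(\<lambda>n. LINT y|M. W (x, y) * norm (f y - F n y)) \<longlonglongrightarrow> (LINT y|M. 0)"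
    proof (rule integral_dominated_convergence)
      show "integrable M (\<lambda>y. W (x, y) * (3 * norm (f y)))"
        using fi x by (intro kernel_integrable[of W 1]) (auto simp: W_nonneg)
      show "AE y in M. (\<lambda>n. W (x, y) * norm (f y - F n y)) \<longlonglongrightarrow> 0"
        using lim
      proof eventually_elim
        case (elim y)
        then have "(\<lambda>n. W (x, y) * norm (f y - F n y)) \<longlonglongrightarrow> W (x, y) * norm (f y - f y)"
          by (intro tendsto_intros)
        then show ?case by simp
      qed
      show "AE y in M. norm (W (x, y) * norm (f y - F n y)) \<le> W (x, y) * (3 * norm (f y))" for n
      proof (rule AE_I2)
        fix y assume "y \<in> space M"
        then have "norm (f y - F n y) \<le> 3 * norm (f y)"
          using norm_triangle_ineq4[of "f y" "F n y"] le[of y n] by linarith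
        then show "norm (W (x, y) * norm (f y - F n y)) \<le> W (x, y) * (3 * norm (f y))"
          using W_nonneg by (auto simp: abs_mult intro!: mult_left_mono)
      qed
    qed (use x in measurable)
    then have "(\<lambda>n. LINT y|M. W (x, y) * norm (f y - F n y)) \<longlonglongrightarrow> 0"
      by simp
    then have "(\<lambda>n. S (\<lambda>y. f y - F n y) x) \<longlonglongrightarrow> 0"
      by (rule Lim_null_comparison[rotated]) (use elim(2) in auto)
    then have "(\<lambda>n. S f x - S (\<lambda>y. f y - F n y) x) \<longlonglongrightarrow> S f x - 0"
      by (intro tendsto_intros)
    moreover have "S f x - S (\<lambda>y. f y - F n y) x = (LINT y|M. K (x, y) * F n y)" for n
      using elim(1,3) by (simp add: algebra_simps)
    ultimately have 1: "(\<lambda>n. LINT y|M. K (x, y) * F n y) \<longlonglongrightarrow> S f x"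
      by simp
    have 2: "(\<lambda>n. LINT y|M. K (x, y) * F n y) \<longlonglongrightarrow> (LINT y|M. K (x, y) * f y)"
    proof (rule integral_dominated_convergence)
      show "integrable M (\<lambda>y. norm (K (x, y)) * (2 * norm (f y)))"
        using fi x K_bound by (intro kernel_integrable[of "\<lambda>z. norm (K z)" 2]) auto
      show "AE y in M. (\<lambda>n. K (x, y) * F n y) \<longlonglongrightarrow> K (x, y) * f y"
        using lim by eventually_elim (intro tendsto_intros)
      show "AE y in M. norm (K (x, y) * F n y) \<le> norm (K (x, y)) * (2 * norm (f y))" for n
        using le by (auto simp: norm_mult intro!: mult_left_mono)
    qed (use x in measurable)
    show ?case
      using LIMSEQ_unique[OF 1 2] .
  qed
qed

text \<open>Simple multiples of \<open>g\<close> approximate every element of the domain that lives on the support of \<open>g\<close>.\<close>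

lemma represents_on_support:
  assumes g: "g \<in> D" and rep: "\<And>B. B \<in> sets M \<Longrightarrow> represents K (trunc B g)"
    and f: "f \<in> D" and supp: "\<And>y. g y = 0 \<Longrightarrow> f y = 0"
  shows "represents K f"
proof -
  have [measurable]: "f \<in> borel_measurable M" "g \<in> borel_measurable M"
    using f g D_measurable by auto
  \<comment> \<open>By the convention on division by 0 the quotient is 0 where \<open>g\<close>
    vanishes, and \<open>f\<close> vanishes there too, so \<open>s i y * g y\<close> tends to
    \<open>f y\<close> at every point.\<close>
  obtain s where s: "\<And>i. simple_function M (s i)"
    and s_lim: "\<And>y. y \<in> space M \<Longrightarrow> (\<lambda>i. s i y) \<longlonglongrightarrow> f y / g y"
    and s_le: "\<And>i y. y \<in> space M \<Longrightarrow> norm (s i y) \<le> 2 * norm (f y / g y)"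
    using borel_measurable_implies_sequence_metric[of "\<lambda>y. f y / g y" M 0]
    by simp metis
  define A where "A i c = s i -` {c} \<inter> space M" for i c
  \<comment> \<open>This is \<open>s i y * g y\<close>, written through truncations of
    \<open>g\<close>, because closure of \<open>D\<close> is given for truncations and linear
    combinations.\<close>
  define F where "F i y = (\<Sum>c\<in>s i ` space M. c * trunc (A i c) g y)" for i y
  have A: "A i c \<in> sets M" for i c
    unfolding A_def using s by (rule simple_functionD)
  have F_eq: "F i y = s i y * g y" if "y \<in> space M" for i y
  proof -
    have "F i y = (\<Sum>c\<in>s i ` space M. if c = s i y then c * g y else 0)"
      unfolding F_def trunc_def A_def using that by (intro sum.cong) (auto simp: indicator_def)
    then show ?thesis
      using that simple_functionD(1)[OF s, of i] by simp
  qed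
  have F: "F i \<in> D \<and> represents K (F i)" for i
    unfolding F_def
  proof (rule represents_sum)
    show "finite (s i ` space M)"
      by (rule simple_functionD(1)[OF s])
    show "(\<lambda>y. c * trunc (A i c) g y) \<in> D" for c
      by (intro D_cmult D_trunc A g)
    show "represents K (\<lambda>y. c * trunc (A i c) g y)" for c
      by (intro represents_cmult D_trunc A g rep)
  qed
  show ?thesis
  proof (rule represents_limit[of F])
    show "AE y in M. (\<lambda>n. F n y) \<longlonglongrightarrow> f y"
    proof (rule AE_I2)
      fix y assume y: "y \<in> space M"
      have "(\<lambda>n. s n y * g y) \<longlonglongrightarrow> f y / g y * g y"
        using s_lim[OF y] by (intro tendsto_intros)
      moreover have "f y / g y * g y = f y"
        using supp[of y] by (cases "g y = 0") auto
      ultimately show "(\<lambda>n. F n y) \<longlonglongrightarrow> f y"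
        by (simp add: F_eq[OF y])
    qed
    show "norm (F n y) \<le> 2 * norm (f y)" if y: "y \<in> space M" for n y
    proof (cases "g y = 0")
      case False
      have "norm (F n y) \<le> 2 * norm (f y / g y) * norm (g y)"
        unfolding F_eq[OF y] norm_mult by (intro mult_right_mono s_le y) auto
      also have "\<dots> = 2 * norm (f y)"
        using False by (simp add: norm_divide)
      finally show ?thesis .
    qed (simp add: F_eq[OF y])
  qed (use f F in auto)
qed

end


text \<open>Real and imaginary parts of \<open>S (trunc B g)\<close> get separate densities; adding
  the two bounds is the origin of the factor 2 in front of \<open>W\<close>.\<close>

lemma ex_kernel_on_support:
  assumes g: "g \<in> D"
  shows "\<exists>K\<in>borel_measurable (M \<Otimes>\<^sub>M M). (\<forall>z. norm (K z) \<le> 2 * W z) \<and>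
    (\<forall>f\<in>D. (\<forall>y. g y = 0 \<longrightarrow> f y = 0) \<longrightarrow> represents K f)"
proof -
  define w where "w z = W z * norm (g (snd z))" for z
  have g_meas [measurable]: "g \<in> borel_measurable M"
    using g by (rule D_measurable)
  have w_meas [measurable]: "w \<in> borel_measurable (M \<Otimes>\<^sub>M M)"
    unfolding w_def by measurable
  have w_nonneg: "0 \<le> w z" for z
    using W_nonneg by (simp add: w_def)
  have w_int: "integrable M (\<lambda>y. w (x, y))" if "x \<in> space M" for x
    unfolding w_def using that D_integrable[OF g]
    by (simp, intro kernel_integrable[of W 1]) (auto simp: W_nonneg)
  have add: "AE x in M. S (trunc (B \<union> C) g) x = S (trunc B g) x + S (trunc C g) x"
    if "B \<in> sets M" "C \<in> sets M" "B \<inter> C = {}" for B C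
  proof -
    have "trunc (B \<union> C) g = (\<lambda>y. trunc B g y + trunc C g y)"
      using that(3) by (auto simp: trunc_def indicator_def fun_eq_iff)
    then show ?thesis
      using S_add[of "trunc B g" "trunc C g"] that D_trunc g by simp
  qed
  have bound: "AE x in M. norm (S (trunc B g) x) \<le> (LINT y:B|M. w (x, y))" if "B \<in> sets M" for B
  proof -
    have "W (x, y) * norm (trunc B g y) = indicator B y *\<^sub>R w (x, y)" for x y
      by (simp add: trunc_def w_def indicator_def)
    then show ?thesis
      using dominated[OF D_trunc[OF that g]] by (simp add: set_lebesgue_integral_def)
  qed
  have S_meas: "S (trunc B g) \<in> borel_measurable M" if "B \<in> sets M" for B
    using that g by (intro S_measurable D_trunc)
  have "\<exists>k\<in>borel_measurable (M \<Otimes>\<^sub>M M). (\<forall>z. \<bar>k z\<bar> \<le> w z) \<and>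
     (\<forall>B\<in>sets M. AE x in M. Re (S (trunc B g) x) = (LINT y:B|M. k (x, y)))"
  proof (rule ex_signed_density[OF _ _ w_meas w_nonneg w_int])
    show "(\<lambda>x. Re (S (trunc B g) x)) \<in> borel_measurable M" if "B \<in> sets M" for B
      using S_meas[OF that] by measurable
    show "AE x in M. Re (S (trunc (B \<union> C) g) x) = Re (S (trunc B g) x) + Re (S (trunc C g) x)"
      if "B \<in> sets M" "C \<in> sets M" "B \<inter> C = {}" for B C
      using add[OF that] by eventually_elim simp
    show "AE x in M. \<bar>Re (S (trunc B g) x)\<bar> \<le> (LINT y:B|M. w (x, y))" if "B \<in> sets M" for B
      using bound[OF that] by eventually_elim (use abs_Re_le_cmod order_trans in blast)
  qed
  then obtain k1 where k1_meas [measurable]: "k1 \<in> borel_measurable (M \<Otimes>\<^sub>M M)" and k1: "\<And>z. \<bar>k1 z\<bar> \<le> w z"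
     "\<And>B. B \<in> sets M \<Longrightarrow> AE x in M. Re (S (trunc B g) x) = (LINT y:B|M. k1 (x, y))"
    by blast
  have "\<exists>k\<in>borel_measurable (M \<Otimes>\<^sub>M M). (\<forall>z. \<bar>k z\<bar> \<le> w z) \<and>
     (\<forall>B\<in>sets M. AE x in M. Im (S (trunc B g) x) = (LINT y:B|M. k (x, y)))"
  proof (rule ex_signed_density[OF _ _ w_meas w_nonneg w_int])
    show "(\<lambda>x. Im (S (trunc B g) x)) \<in> borel_measurable M" if "B \<in> sets M" for B
      using S_meas[OF that] by measurable
    show "AE x in M. Im (S (trunc (B \<union> C) g) x) = Im (S (trunc B g) x) + Im (S (trunc C g) x)"
      if "B \<in> sets M" "C \<in> sets M" "B \<inter> C = {}" for B C
      using add[OF that] by eventually_elim simp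
    show "AE x in M. \<bar>Im (S (trunc B g) x)\<bar> \<le> (LINT y:B|M. w (x, y))" if "B \<in> sets M" for B
      using bound[OF that] by eventually_elim (use abs_Im_le_cmod order_trans in blast)
  qed
  then obtain k2 where k2_meas [measurable]: "k2 \<in> borel_measurable (M \<Otimes>\<^sub>M M)" and k2: "\<And>z. \<bar>k2 z\<bar> \<le> w z"
     "\<And>B. B \<in> sets M \<Longrightarrow> AE x in M. Im (S (trunc B g) x) = (LINT y:B|M. k2 (x, y))"
    by blast
  \<comment> \<open>Both densities are bounded by \<open>W (x, y) * norm (g y)\<close>. They vanish
    where \<open>g\<close> does, so nothing is lost when the quotient is 0 there by
    convention.\<close>
  define K where "K z = (complex_of_real (k1 z) + \<i> * complex_of_real (k2 z)) / g (snd z)" for z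
  have K_meas [measurable]: "K \<in> borel_measurable (M \<Otimes>\<^sub>M M)"
    unfolding K_def by measurable
  have K_bound: "norm (K z) \<le> 2 * W z" for z
  proof (cases "g (snd z) = 0")
    case False
    have "norm (complex_of_real (k1 z) + \<i> * complex_of_real (k2 z)) \<le> \<bar>k1 z\<bar> + \<bar>k2 z\<bar>"
      by (rule norm_triangle_le) (simp add: norm_mult)
    also have "\<dots> \<le> 2 * W z * norm (g (snd z))"
      using k1(1)[of z] k2(1)[of z] unfolding w_def by linarith
    finally show ?thesis
      using False by (simp add: K_def norm_divide divide_le_eq)
  qed (simp add: K_def W_nonneg)
  have "represents K (trunc B g)" if B: "B \<in> sets M" for B
    unfolding represents_def using k1(2)[OF B] k2(2)[OF B] AE_space
  proof eventually_elim
    case (elim x)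
    have k_int: "integrable M (\<lambda>y. indicator B y *\<^sub>R k (x, y))"
      if [measurable]: "k \<in> borel_measurable (M \<Otimes>\<^sub>M M)" and k: "\<And>z. \<bar>k z\<bar> \<le> w z" for k
    proof (rule integrable_mult_indicator[OF B])
      show "integrable M (\<lambda>y. k (x, y))"
      proof (rule Bochner_Integration.integrable_bound[OF w_int[OF elim(3)]])
        show "AE y in M. norm (k (x, y)) \<le> norm (w (x, y))"
          using k w_nonneg by auto
      qed (use elim(3) in measurable)
    qed
    have "K (x, y) * trunc B g y = complex_of_real (indicator B y *\<^sub>R k1 (x, y)) +
        \<i> * complex_of_real (indicator B y *\<^sub>R k2 (x, y))" for y
    proof (cases "g y = 0")
      case True
      then have "k1 (x, y) = 0" "k2 (x, y) = 0"
        using k1(1)[of "(x, y)"] k2(1)[of "(x, y)"] by (auto simp: w_def)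
      then show ?thesis using True by (simp add: trunc_def)
    qed (simp add: K_def trunc_def indicator_def)
    then have "(LINT y|M. K (x, y) * trunc B g y) =
        (LINT y|M. complex_of_real (indicator B y *\<^sub>R k1 (x, y)) + \<i> * complex_of_real (indicator B y *\<^sub>R k2 (x, y)))"
      by simp
    also have "\<dots> = complex_of_real (LINT y:B|M. k1 (x, y)) + \<i> * complex_of_real (LINT y:B|M. k2 (x, y))"
      unfolding set_lebesgue_integral_def
      using k_int[OF k1_meas k1(1)] k_int[OF k2_meas k2(1)]
      by (subst Bochner_Integration.integral_add)
        (auto intro!: integrable_mult_right integrable_of_real simp del: of_real_mult real_scaleR_def)
    also have "\<dots> = S (trunc B g) x"
      using elim by (simp add: complex_eq_iff)
    finally show ?case by simp
  qed
  then show ?thesis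
    using represents_on_support[OF K_meas K_bound g] K_meas K_bound
    by (intro bexI[of _ K]) blast+
qed

text \<open>Exhaustion: the \<open>F m\<close> have supports whose mass comes within
  \<open>1 / Suc m\<close> of the supremum over \<open>D\<close>. An \<open>f\<close> that is
  nonzero where all \<open>F m\<close> vanish could be added to \<open>F m\<close> there and would
  enlarge its support, so the set in question has mass at most \<open>1 / Suc m\<close> for every
  \<open>m\<close>.\<close>

lemma ex_countable_support:
  "\<exists>F :: nat \<Rightarrow> 'a \<Rightarrow> complex.
    (\<forall>m. F m \<in> D) \<and> (\<forall>f\<in>D. AE y in M. (\<forall>m. F m y = 0) \<longrightarrow> f y = 0)"
proof -
  \<comment> \<open>Weighting by a positive integrable function gives a finite measure with the same
    null sets, so the supremum of the masses is finite.\<close>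
  obtain h :: "'a \<Rightarrow> real" where h [measurable]: "h \<in> borel_measurable M"
    and h_pos: "\<And>x. h x > 0" and h_int: "integrable M h"
    using obtain_positive_integrable_function by metis
  have h_set: "set_integrable M A h" if "A \<in> sets M" for A
    unfolding set_integrable_def using that h_int by (rule integrable_mult_indicator)
  have h_mono: "(LINT y:A|M. h y) \<le> (LINT y:B|M. h y)" if "A \<in> sets M" "B \<in> sets M" "A \<subseteq> B" for A B
    using that h_pos[THEN less_imp_le] h_set[OF that(1)] h_set[OF that(2)]
    unfolding set_lebesgue_integral_def set_integrable_def
    by (intro integral_mono) (auto simp: indicator_def)
  define U where "U f = {y \<in> space M. f y \<noteq> 0}" for f :: "'a \<Rightarrow> complex"
  define \<Phi> where "\<Phi> f = (LINT y:U f|M. h y)" for f :: "'a \<Rightarrow> complex"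
  have U: "U f \<in> sets M" if "f \<in> D" for f
    unfolding U_def using D_measurable[OF that] by measurable
  have "\<Phi> f \<le> (LINT y:space M|M. h y)" if "f \<in> D" for f
    unfolding \<Phi>_def using U[OF that] by (intro h_mono) (auto simp: U_def)
  then have bdd: "bdd_above (\<Phi> ` D)"
    by (auto intro!: bdd_aboveI)
  have "\<exists>f\<in>D. (SUP f\<in>D. \<Phi> f) - 1 / real (Suc m) < \<Phi> f" for m
    using D_closed(1) by (subst less_cSUP_iff[symmetric, OF _ bdd]) auto
  then obtain F where F: "\<And>m. F m \<in> D" "\<And>m. (SUP f\<in>D. \<Phi> f) - 1 / real (Suc m) < \<Phi> (F m)"
    by metis
  have "AE y in M. (\<forall>m. F m y = 0) \<longrightarrow> f y = 0" if f: "f \<in> D" for f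
  proof -
    define N where "N = {y \<in> space M. f y \<noteq> 0 \<and> (\<forall>m. F m y = 0)}"
    have [measurable]: "f \<in> borel_measurable M" "F m \<in> borel_measurable M" for m
      using f F D_measurable by auto
    have N [measurable]: "N \<in> sets M"
      unfolding N_def by measurable
    have "(LINT y:N|M. h y) \<le> 1 / real (Suc m)" for m
    proof -
      \<comment> \<open>Restricting \<open>f\<close> to the zero set of \<open>F m\<close> excludes
        cancellation in the sum \<open>p\<close>; its support contains both that of
        \<open>F m\<close> and \<open>N\<close>.\<close>
      define Z where "Z = {y \<in> space M. F m y = 0}"
      have Z: "Z \<in> sets M" unfolding Z_def by measurable
      define p where "p y = F m y + trunc Z f y" for y
      have p: "p \<in> D"
        unfolding p_def using F f Z by (intro D_add D_trunc)
      have "(LINT y:U (F m)|M. h y) + (LINT y:N|M. h y) = (LINT y:U (F m) \<union> N|M. h y)"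
        using U F N h_set by (intro set_integral_Un[symmetric]) (auto simp: U_def N_def)
      also have "\<dots> \<le> (LINT y:U p|M. h y)"
        using U F N p
        by (intro h_mono) (auto simp: U_def N_def p_def Z_def trunc_def indicator_def)
      also have "\<dots> \<le> (SUP f\<in>D. \<Phi> f)"
        using cSUP_upper[OF p bdd] by (simp add: \<Phi>_def)
      finally show ?thesis
        using F(2)[of m] by (simp add: \<Phi>_def)
    qed
    then have "(LINT y:N|M. h y) \<le> 0"
      using LIMSEQ_inverse_real_of_nat by (intro LIMSEQ_le_const) (auto simp: inverse_eq_divide)
    moreover have "0 \<le> (LINT y:N|M. h y)"
      unfolding set_lebesgue_integral_def using h_pos[THEN less_imp_le] by (intro Bochner_Integration.integral_nonneg) simp
    ultimately have "(LINT y|M. indicator N y *\<^sub>R h y) = 0"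
      unfolding set_lebesgue_integral_def by simp
    then have "AE y in M. indicator N y *\<^sub>R h y = 0"
      using h_set[OF N] h_pos[THEN less_imp_le]
      by (subst (asm) integral_nonneg_eq_0_iff_AE) (auto simp: set_integrable_def)
    then show ?thesis
      using AE_space
    proof eventually_elim
      case (elim y)
      then have "y \<notin> N"
        using h_pos[of y] by (auto simp: indicator_def split: if_splits)
      with elim(2) show ?case by (auto simp: N_def)
    qed
  qed
  with F(1) show ?thesis
    by blast
qed

theorem ex_kernel:
  "\<exists>K\<in>borel_measurable (M \<Otimes>\<^sub>M M). (\<forall>z. norm (K z) \<le> 2 * W z) \<and>
    (\<forall>f\<in>D. AE x in M. S f x = (LINT y|M. K (x, y) * f y))"
proof -
  obtain F :: "nat \<Rightarrow> 'a \<Rightarrow> complex" where F: "\<And>m. F m \<in> D" "\<And>f. f \<in> D \<Longrightarrow> AE y in M. (\<forall>m. F m y = 0) \<longrightarrow> f y = 0"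
    using ex_countable_support by blast
  have "\<forall>m. \<exists>K\<in>borel_measurable (M \<Otimes>\<^sub>M M). (\<forall>z. norm (K z) \<le> 2 * W z) \<and>
      (\<forall>f\<in>D. (\<forall>y. F m y = 0 \<longrightarrow> f y = 0) \<longrightarrow> represents K f)"
    using ex_kernel_on_support F(1) by blast
  then obtain \<kappa> where \<kappa> [measurable]: "\<And>m. \<kappa> m \<in> borel_measurable (M \<Otimes>\<^sub>M M)"
    and \<kappa>_bound: "\<And>m z. norm (\<kappa> m z) \<le> 2 * W z"
    and \<kappa>_rep: "\<And>m f. f \<in> D \<Longrightarrow> (\<And>y. F m y = 0 \<Longrightarrow> f y = 0) \<Longrightarrow> represents (\<kappa> m) f"
    by metis
  have [measurable]: "F m \<in> borel_measurable M" for m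
    using F(1) by (rule D_measurable)
  \<comment> \<open>Where all \<open>F m\<close> vanish this index is unspecified; every element of
    \<open>D\<close> is 0 almost everywhere on that set.\<close>
  define idx where "idx y = (LEAST m. F m y \<noteq> 0)" for y
  have [measurable]: "idx \<in> measurable M (count_space UNIV)"
    unfolding idx_def by measurable
  define K where "K z = \<kappa> (idx (snd z)) z" for z
  have K_meas: "K \<in> borel_measurable (M \<Otimes>\<^sub>M M)"
    unfolding K_def by (rule measurable_compose_countable[where g="\<lambda>z. idx (snd z)"]) measurable
  have K_bound: "norm (K z) \<le> 2 * W z" for z
    unfolding K_def by (rule \<kappa>_bound)
  have "represents K f" if f: "f \<in> D" for f
  proof -
    \<comment> \<open>\<open>idx y = m\<close> alone does not give \<open>F m y \<noteq> 0\<close>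
      where the index is unspecified. With both conditions, \<open>trunc (G m) f\<close> lives on
      the support of \<open>F m\<close>, where \<open>\<kappa> m\<close> represents the
      operator.\<close>
    define G where "G m = {y \<in> space M. F m y \<noteq> 0 \<and> idx y = m}" for m
    have G: "G m \<in> sets M" for m
      unfolding G_def by measurable
    define p where "p n y = (\<Sum>m<n. trunc (G m) f y)" for n y
    have "represents K (trunc (G m) f)" for m
    proof -
      have "represents (\<kappa> m) (trunc (G m) f)"
        using D_trunc[OF G f] by (rule \<kappa>_rep) (auto simp: trunc_def G_def)
      moreover have "K (x, y) * trunc (G m) f y = \<kappa> m (x, y) * trunc (G m) f y" for x y
        by (auto simp: K_def trunc_def G_def indicator_def)
      ultimately show ?thesis
        by (simp only: represents_def)
    qed
    then have p: "p n \<in> D \<and> represents K (p n)" for n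
      unfolding p_def using D_trunc[OF G f]
      by (intro represents_sum[OF K_meas K_bound]) auto
    have p_eq: "p n y = (if (\<exists>m. F m y \<noteq> 0) \<and> idx y < n then f y else 0)" if "y \<in> space M" for n y
    proof (cases "\<exists>m. F m y \<noteq> 0")
      case True
      then have "F (idx y) y \<noteq> 0"
        unfolding idx_def by (rule LeastI_ex)
      then have "p n y = (\<Sum>m<n. if m = idx y then f y else 0)"
        unfolding p_def trunc_def G_def using that by (intro sum.cong) (auto simp: indicator_def)
      with True show ?thesis by simp
    next
      case False
      then show ?thesis
        by (simp add: p_def trunc_def G_def)
    qed
    show ?thesis
    proof (rule represents_limit[OF K_meas K_bound, of p])
      show "AE y in M. (\<lambda>n. p n y) \<longlonglongrightarrow> f y"
        using F(2)[OF f] AE_space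
      proof eventually_elim
        case (elim y)
        have "\<forall>\<^sub>F n in sequentially. p n y = f y"
          using eventually_gt_at_top[of "idx y"]
          by eventually_elim (use elim p_eq in auto)
        then show ?case by (rule tendsto_eventually)
      qed
    qed (use p f p_eq in auto)
  qed
  then show ?thesis
    using K_meas K_bound unfolding represents_def by blast
qed

end

subsection \<open>Doubling measures\<close>

text \<open>Translates between extended-real averages and real bounds almost everywhere. One
  direction exploits given estimates, the other establishes them.\<close>

lemma avg_norm_infinity_le_iff:
  assumes A [measurable]: "A \<in> sets M" and Q: "Q \<in> sets M"
    and g [measurable]: "g \<in> borel_measurable M" and f: "integrable M f"
    and E: "0 < measure M E" and a: "0 \<le> a"
  shows "avg_norm M \<infinity> E' A g \<le> ennreal a * avg_norm M 1 E Q f \<longleftrightarrow>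
    (AE x in M. x \<in> A \<longrightarrow> norm (g x) \<le> a / measure M E * (LINT x:Q|M. norm (f x)))"
proof -
  define I where "I = (LINT x:Q|M. norm (f x))"
  have f_set: "set_integrable M Q (\<lambda>x. norm (f x))"
    unfolding set_integrable_def using Q f by (intro integrable_mult_indicator) auto
  have I: "0 \<le> I"
    unfolding I_def set_lebesgue_integral_def by (intro Bochner_Integration.integral_nonneg) simp
  have "(\<integral>\<^sup>+x\<in>Q. ennreal (norm (f x)) \<partial>M) = (\<integral>\<^sup>+x. ennreal (indicator Q x *\<^sub>R norm (f x)) \<partial>M)"
    by (intro nn_integral_cong) (simp add: indicator_def)
  also have "\<dots> = ennreal I"
    unfolding I_def set_lebesgue_integral_def using f_set
    by (intro nn_integral_eq_integral) (auto simp: set_integrable_def)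
  finally have nn: "(\<integral>\<^sup>+x\<in>Q. ennreal (norm (f x)) \<partial>M) = ennreal I" .
  \<comment> \<open>Positivity also excludes infinite mass, since \<open>measure\<close> sends
    infinity to 0.\<close>
  have "emeasure M E = ennreal (measure M E)"
    using E by (metis emeasure_eq_ennreal_measure ennreal_0 ennreal_top_neq_zero infinity_ennreal_def less_irrefl measure_def enn2real_top)
  then have "avg_norm M 1 E Q f = ennroot 1 (ennreal (I / measure M E))"
    using E I by (simp add: avg_norm_def nn divide_ennreal)
  also have "\<dots> = ennreal (I / measure M E)"
    using E I by (simp add: ennroot_def)
  finally have "ennreal a * avg_norm M 1 E Q f = ennreal (a / measure M E * I)"
    using E I a by (simp add: ennreal_mult[symmetric])
  moreover have "avg_norm M \<infinity> E' A g \<le> c \<longleftrightarrow> (AE x in M. indicator A x * ennreal (norm (g x)) \<le> c)" for c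
  proof
    assume "avg_norm M \<infinity> E' A g \<le> c"
    then show "AE x in M. indicator A x * ennreal (norm (g x)) \<le> c"
      using esssup_AE[of "\<lambda>x. indicator A x * ennreal (norm (g x))" M]
      by (auto simp: avg_norm_def elim!: eventually_mono intro: order_trans)
  next
    assume "AE x in M. indicator A x * ennreal (norm (g x)) \<le> c"
    then show "avg_norm M \<infinity> E' A g \<le> c"
      unfolding avg_norm_def by (simp, intro esssup_I) auto
  qed
  moreover have "indicator A x * ennreal (norm (g x)) \<le> ennreal (a / measure M E * I) \<longleftrightarrow>
      (x \<in> A \<longrightarrow> norm (g x) \<le> a / measure M E * I)" for x
    using a E I by (auto simp: indicator_def)
  ultimately show ?thesis
    by (simp add: I_def)
qed

lemma Upsilon_ge: "0 < s \<Longrightarrow> 1 \<le> Upsilon s" "s \<le> Upsilon s"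
  unfolding Upsilon_def by (cases "1 \<le> s"; simp add: le_max_iff_disj)+

text \<open>The nondegenerate case, with real-valued measures of balls. The normalisation of
  \<open>C0\<close> makes its base-2 logarithm positive, as the exponent \<theta>2 of the estimates
  has to be.\<close>

locale doubling_measure =
  fixes M :: "'a::metric_space measure" and C0 :: real
  assumes sets_eq_borel [measurable_cong]: "sets M = sets borel"
    and C0_ge_2: "2 \<le> C0"
    and ball_pos: "0 < r \<Longrightarrow> 0 < measure M (ball x r)"
    and ball_double: "0 < r \<Longrightarrow> measure M (ball x (2 * r)) \<le> C0 * measure M (ball x r)"

text \<open>If one ball is null, so are its dyadic multiples by doubling, and these exhaust the
  space.\<close>

lemma homogeneous_type_cases:
  fixes M :: "'a::metric_space measure"
  assumes "space_of_homogeneous_type M"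
  obtains "space M \<in> null_sets M" | C0 where "doubling_measure M C0"
proof -
  obtain C0 :: real where sets [measurable_cong]: "sets M = sets borel" and
    C0: "\<And>x r. 0 < r \<Longrightarrow> emeasure M (ball x (2 * r)) \<le> ennreal C0 * emeasure M (ball x r)"
      "\<And>x r. 0 < r \<Longrightarrow> ennreal C0 * emeasure M (ball x r) < \<infinity>"
    using assms unfolding space_of_homogeneous_type_def by blast
  have ball [measurable]: "ball x r \<in> sets M" for x r
    by (simp add: sets)
  show thesis
  proof (cases "\<exists>x r. 0 < r \<and> emeasure M (ball x r) = 0")
    case True
    then obtain x r where r: "0 < r" "emeasure M (ball x r) = 0" by blast
    have null: "emeasure M (ball x (2 ^ n * r)) = 0" for n
    proof (induction n)
      case (Suc n)
      then show ?case
        using C0(1)[of "2 ^ n * r" x] r by (simp add: mult.assoc)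
    qed (use r in simp)
    have "(\<Union>n. ball x (2 ^ n * r)) = UNIV"
    proof (intro equalityI subsetI)
      fix y
      obtain n where "dist x y / r < 2 ^ n"
        using real_arch_pow[of 2 "dist x y / r"] by auto
      then show "y \<in> (\<Union>n. ball x (2 ^ n * r))"
        using r by (auto simp: field_simps)
    qed simp
    moreover have "(\<Union>n. ball x (2 ^ n * r)) \<in> null_sets M"
      using null by (intro null_sets_UN) (auto simp: null_sets_def)
    ultimately show thesis
      using that(1) sets_eq_imp_space_eq[OF sets] by simp
  next
    case False
    then have pos: "0 < emeasure M (ball x r)" if "0 < r" for x r
      using that by (simp add: zero_less_iff_neq_zero)
    \<comment> \<open>A nonpositive \<open>C0\<close> would make all balls null. Once
      \<open>ennreal C0\<close> is positive, finiteness of its product with the measure of a ball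
      yields finiteness of the measure. \<open>undefined\<close> is just some point of the
      space.\<close>
    have "0 < ennreal C0 * emeasure M (ball undefined 1)"
      using C0(1)[of 1 undefined] pos[of 2 undefined] by (metis mult_1_right order_less_le_trans zero_less_one zero_less_numeral)
    then have C0_pos: "0 < ennreal C0"
      by (simp add: ennreal_zero_less_mult_iff)
    have fin: "emeasure M (ball x r) = ennreal (measure M (ball x r))" if "0 < r" for x r
      using C0(2)[OF that, of x] C0_pos
      by (intro emeasure_eq_ennreal_measure) (auto simp: ennreal_mult_less_top)
    have "doubling_measure M (max 2 C0)"
    proof
      show "0 < measure M (ball x r)" if "0 < r" for x r
        using pos[OF that, of x] fin[OF that, of x] by simp
      show "measure M (ball x (2 * r)) \<le> max 2 C0 * measure M (ball x r)" if "0 < r" for x r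
      proof -
        have "ennreal (measure M (ball x (2 * r))) \<le> ennreal (C0 * measure M (ball x r))"
          using C0(1)[OF that, of x] C0_pos fin[of r x] fin[of "2 * r" x] that
          by (simp add: ennreal_mult)
        then have "measure M (ball x (2 * r)) \<le> C0 * measure M (ball x r)"
          using C0_pos by (subst (asm) ennreal_le_iff) auto
        also have "\<dots> \<le> max 2 C0 * measure M (ball x r)"
          by (intro mult_right_mono) auto
        finally show ?thesis .
      qed
    qed (use sets in auto)
    then show thesis by (rule that(2))
  qed
qed

section \<open>Growth of balls, packing and nets\<close>

context doubling_measure
begin

lemma space_eq_UNIV [simp]: "space M = UNIV"
  using sets_eq_imp_space_eq[OF sets_eq_borel] by simp

lemma ball_in_sets [simp, measurable]: "ball x r \<in> sets M"
  by (simp add: sets_eq_borel)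

lemma annulus_in_sets [simp, measurable]: "annulus x r j \<in> sets M"
  unfolding annulus_def by simp

lemma ball_finite: "emeasure M (ball x r) \<noteq> \<infinity>"
proof (cases "0 < r")
  case True
  then show ?thesis
    using ball_pos[OF True, of x] by (auto simp: measure_def)
qed (simp add: ball_empty)

lemma ball_mono:
  assumes "ball x r \<subseteq> ball y s"
  shows "measure M (ball x r) \<le> measure M (ball y s)"
  using assms ball_finite[of y s] by (intro measure_mono_fmeasurable) (auto simp: fmeasurable_def less_top)

sublocale sigma_finite_measure M
proof
  have "(\<Union>n. ball undefined (real n)) = (UNIV :: 'a set)"
    by (auto intro: reals_Archimedean2)
  then show "\<exists>A. countable A \<and> A \<subseteq> sets M \<and> \<Union>A = space M \<and> (\<forall>a\<in>A. emeasure M a \<noteq> \<infinity>)"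
    using ball_finite by (intro exI[of _ "range (\<lambda>n. ball undefined (real n))"]) auto
qed

lemma ball_double_power:
  assumes "0 < r"
  shows "measure M (ball x (2 ^ n * r)) \<le> C0 ^ n * measure M (ball x r)"
proof (induction n)
  case (Suc n)
  have "measure M (ball x (2 ^ Suc n * r)) \<le> C0 * measure M (ball x (2 ^ n * r))"
    using ball_double[of "2 ^ n * r" x] assms by (simp add: mult.assoc)
  also have "\<dots> \<le> C0 * (C0 ^ n * measure M (ball x r))"
    using Suc C0_ge_2 by (intro mult_left_mono) auto
  finally show ?case by (simp add: mult.assoc)
qed simp

text \<open>The homogeneous dimension attached to \<open>C0\<close>: doubling the radius costs
  \<open>2 powr dim\<close>.\<close>

definition dim :: real where "dim = log 2 C0"

lemma dim_pos: "0 < dim"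
  unfolding dim_def using C0_ge_2 by simp

text \<open>Iterated doubling; the extra factor \<open>C0\<close> pays for rounding
  \<open>log 2 m\<close> up to an integer.\<close>

lemma ball_growth:
  assumes r: "0 < r" and m: "1 \<le> m" "R \<le> m * r"
  shows "measure M (ball x R) \<le> C0 * m powr dim * measure M (ball x r)"
proof -
  define n where "n = nat \<lceil>log 2 m\<rceil>"
  have "0 \<le> log 2 m" using m by simp
  then have n: "log 2 m \<le> real n" "real n \<le> log 2 m + 1"
    unfolding n_def by linarith+
  have "m = 2 powr log 2 m" using m by simp
  also have "\<dots> \<le> 2 powr real n" using n by simp
  finally have m_le: "m \<le> 2 ^ n" by (simp add: powr_realpow)
  have "R \<le> 2 ^ n * r"
    using m(2) mult_right_mono[OF m_le, of r] r by linarith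
  then have "measure M (ball x R) \<le> measure M (ball x (2 ^ n * r))"
    by (intro ball_mono subset_ball)
  also have "\<dots> \<le> C0 ^ n * measure M (ball x r)"
    by (rule ball_double_power[OF r])
  also have "C0 ^ n = 2 powr (dim * real n)"
    using C0_ge_2 by (simp add: dim_def powr_powr[symmetric] powr_realpow)
  also have "\<dots> \<le> 2 powr (dim * (log 2 m + 1))"
    using n dim_pos by (intro powr_mono mult_left_mono) auto
  also have "\<dots> = 2 powr dim * (2 powr log 2 m) powr dim"
    by (simp add: powr_powr powr_add[symmetric] algebra_simps)
  also have "\<dots> = C0 * m powr dim"
    using C0_ge_2 m by (simp add: dim_def)
  finally show ?thesis
    by (simp add: mult_right_mono)
qed

text \<open>Packing by volume: the balls of radius \<open>\<rho> / 2\<close> around separated points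
  are disjoint, lie in \<open>ball z (R + \<rho>)\<close>, and each carries a fixed fraction of its
  measure. The base of the power is the ratio of \<open>2 * (R + \<rho>)\<close> to
  \<open>\<rho> / 2\<close>.\<close>

lemma separated_card_le:
  fixes z :: 'a
  assumes \<rho>: "0 < \<rho>" and R: "0 < R" and F: "finite F" "F \<subseteq> ball z R"
    and sep: "\<And>a b. a \<in> F \<Longrightarrow> b \<in> F \<Longrightarrow> a \<noteq> b \<Longrightarrow> \<rho> \<le> dist a b"
  shows "real (card F) \<le> C0 * (4 * (R + \<rho>) / \<rho>) powr dim"
proof -
  define c where "c = C0 * (4 * (R + \<rho>) / \<rho>) powr dim"
  define V where "V = measure M (ball z (R + \<rho>))"
  have V: "0 < V" unfolding V_def using \<rho> R by (intro ball_pos) simp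
  have c: "0 < c" unfolding c_def using \<rho> R C0_ge_2 by simp
  have V_le: "V \<le> c * measure M (ball a (\<rho> / 2))" if "a \<in> F" for a
  proof -
    have "ball z (R + \<rho>) \<subseteq> ball a (2 * (R + \<rho>))"
    proof
      fix y assume "y \<in> ball z (R + \<rho>)"
      moreover have "dist z a < R" using that F(2) by auto
      ultimately show "y \<in> ball a (2 * (R + \<rho>))"
        using dist_triangle3[of a y z] \<rho> by simp
    qed
    then have "V \<le> measure M (ball a (2 * (R + \<rho>)))"
      unfolding V_def by (rule ball_mono)
    also have "\<dots> \<le> c * measure M (ball a (\<rho> / 2))"
      unfolding c_def using \<rho> R by (intro ball_growth) (auto simp: field_simps)
    finally show ?thesis .
  qed
  have disj: "disjoint_family_on (\<lambda>a. ball a (\<rho> / 2)) F"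
    unfolding disjoint_family_on_def
  proof safe
    fix a b y assume ab: "a \<in> F" "b \<in> F" "a \<noteq> b" and y: "y \<in> ball a (\<rho> / 2)" "y \<in> ball b (\<rho> / 2)"
    have "dist a b < \<rho>"
      using y dist_triangle2[of a b y] by (simp add: dist_commute)
    then show "y \<in> {}" using sep[OF ab] by simp
  qed
  have "real (card F) * V \<le> (\<Sum>a\<in>F. c * measure M (ball a (\<rho> / 2)))"
    using sum_mono[of F "\<lambda>_. V"] V_le by simp
  also have "\<dots> = c * measure M (\<Union>a\<in>F. ball a (\<rho> / 2))"
    unfolding sum_distrib_left[symmetric] using F(1) disj ball_finite
    by (subst measure_finite_Union) auto
  also have "\<dots> \<le> c * V"
  proof -
    have "(\<Union>a\<in>F. ball a (\<rho> / 2)) \<subseteq> ball z (R + \<rho>)"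
    proof safe
      fix a y assume "a \<in> F" "y \<in> ball a (\<rho> / 2)"
      moreover have "dist z a < R" using \<open>a \<in> F\<close> F(2) by auto
      ultimately show "y \<in> ball z (R + \<rho>)"
        using dist_triangle[of z y a] \<rho> by simp
    qed
    then show ?thesis
      unfolding V_def using c ball_finite[of z] F(1)
      by (intro mult_left_mono measure_mono_fmeasurable) (auto simp: fmeasurable_def less_top)
  qed
  finally show ?thesis
    using V by (simp add: c_def)
qed

text \<open>The packing bound gives a separated set of greatest cardinality. A point at distance at
  least \<open>\<rho>\<close> from all its members could be added to it.\<close>

lemma ex_finite_net:
  fixes z :: 'a
  assumes \<rho>: "0 < \<rho>" and R: "0 < R"
  shows "\<exists>F. finite F \<and> ball z R \<subseteq> (\<Union>a\<in>F. ball a \<rho>)"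
proof -
  define P where "P F \<longleftrightarrow> finite F \<and> F \<subseteq> ball z R \<and> (\<forall>a\<in>F. \<forall>b\<in>F. a \<noteq> b \<longrightarrow> \<rho> \<le> dist a b)" for F
  define b where "b = C0 * (4 * (R + \<rho>) / \<rho>) powr dim"
  have "\<forall>F. P F \<longrightarrow> card F < Suc (nat \<lceil>b\<rceil>)"
  proof (intro allI impI)
    fix F assume "P F"
    then have "real (card F) \<le> b"
      unfolding b_def P_def by (intro separated_card_le[OF \<rho> R, of _ z]) auto
    then show "card F < Suc (nat \<lceil>b\<rceil>)" by linarith
  qed
  moreover have "P {}" by (simp add: P_def)
  ultimately obtain F where F: "P F" and max: "\<And>F'. P F' \<Longrightarrow> card F' \<le> card F"
    using ex_has_greatest_nat[of P "{}" card "Suc (nat \<lceil>b\<rceil>)"] by blast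
  have "ball z R \<subseteq> (\<Union>a\<in>F. ball a \<rho>)"
  proof
    fix y assume y: "y \<in> ball z R"
    show "y \<in> (\<Union>a\<in>F. ball a \<rho>)"
    proof (rule ccontr)
      assume *: "y \<notin> (\<Union>a\<in>F. ball a \<rho>)"
      then have "\<rho> \<le> dist a y" if "a \<in> F" for a using that by force
      then have "P (insert y F)"
        using F y unfolding P_def by (auto simp: dist_commute)
      moreover have "y \<notin> F" using * \<rho> by force
      ultimately show False
        using max[of "insert y F"] F by (simp add: P_def)
    qed
  qed
  then show ?thesis
    using F by (auto simp: P_def)
qed

text \<open>Doubling supplies the separability of the space. An enumeration by naturals is produced
  so that a nearby net point can later be chosen measurably as the first one.\<close>

lemma ex_countable_net:
  assumes \<rho>: "0 < \<rho>"
  shows "\<exists>X :: nat \<Rightarrow> 'a. \<forall>y. \<exists>i. dist (X i) y < \<rho>"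
proof -
  have "\<forall>n. \<exists>F :: 'a set. finite F \<and> ball undefined (real (Suc n)) \<subseteq> (\<Union>a\<in>F. ball a \<rho>)"
    using \<rho> by (intro allI ex_finite_net) auto
  then obtain F :: "nat \<Rightarrow> 'a set" where F: "\<And>n. finite (F n)" "\<And>n. ball undefined (real (Suc n)) \<subseteq> (\<Union>a\<in>F n. ball a \<rho>)"
    by metis
  define N where "N = (\<Union>n. F n)"
  have N: "\<exists>a\<in>N. dist a y < \<rho>" for y
  proof -
    obtain n where "dist undefined y < real n" using reals_Archimedean2 by blast
    then have "y \<in> ball undefined (real (Suc n))" by simp
    then obtain a where "a \<in> F n" "y \<in> ball a \<rho>" using F(2)[of n] by blast
    then show ?thesis by (auto simp: N_def)
  qed
  then have "N \<noteq> {}" by blast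
  moreover have "countable N"
    unfolding N_def using F(1) by (intro countable_UN) (auto intro: countable_finite)
  ultimately have "range (from_nat_into N) = N"
    by (rule range_from_nat_into)
  then show ?thesis
    using N by (intro exI[of _ "from_nat_into N"]) (metis rangeE)
qed

end

subsection \<open>Off-diagonal estimates\<close>

context doubling_measure
begin

text \<open>The common core of the three estimates, with input on \<open>Q\<close> and output on
  \<open>A\<close>. \<open>ball z \<rho>\<close> normalises the input average, \<open>m\<close>
  compares it with a ball of radius \<open>s\<close> around the points of \<open>A\<close>, and
  \<open>e\<close> bounds the Gaussian factor between \<open>A\<close> and \<open>Q\<close>.\<close>

lemma kernel_estimate:
  fixes T :: "('a \<Rightarrow> complex) \<Rightarrow> 'a \<Rightarrow> complex" and K :: "'a \<times> 'a \<Rightarrow> complex"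
  assumes f: "integrable M f" and T: "T (trunc Q f) \<in> borel_measurable M"
    and rep: "AE x in M. T (trunc Q f) x = (LINT y|M. K (x, y) * trunc Q f y)"
    and K_int: "AE x in M. integrable M (\<lambda>y. K (x, y) * trunc Q f y)"
    and K: "AE x in M. AE y in M. norm (K (x, y)) \<le> C / measure M (ball x s) * exp (- (c * (dist x y)\<^sup>2 / t))"
    and A: "A \<in> sets M" and Q: "Q \<in> sets M"
    and pos: "0 < s" "0 < \<rho>" "0 < C"
    and sub: "\<And>x. x \<in> A \<Longrightarrow> ball z \<rho> \<subseteq> ball x R" and R: "1 \<le> m" "R \<le> m * s"
    and e: "0 \<le> e" "\<And>x y. x \<in> A \<Longrightarrow> y \<in> Q \<Longrightarrow> exp (- (c * (dist x y)\<^sup>2 / t)) \<le> e"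
    and a: "C * C0 * m powr dim * e \<le> a"
  shows "avg_norm M \<infinity> E A (T (trunc Q f)) \<le> ennreal a * avg_norm M 1 (ball z \<rho>) Q f"
proof -
  define \<kappa> where "\<kappa> = a / measure M (ball z \<rho>)"
  have "0 \<le> C * C0 * m powr dim * e"
    using pos C0_ge_2 e(1) by simp
  with a have a_nonneg: "0 \<le> a" by simp
  have fQ: "integrable M (\<lambda>y. indicator Q y *\<^sub>R norm (f y))"
    using Q f by (intro integrable_mult_indicator) auto
  have kernel_le: "C / measure M (ball x s) * exp (- (c * (dist x y)\<^sup>2 / t)) \<le> \<kappa>"
    if "x \<in> A" "y \<in> Q" for x y
  proof -
    have "measure M (ball z \<rho>) \<le> measure M (ball x R)"
      using sub[OF that(1)] by (rule ball_mono)
    also have "\<dots> \<le> C0 * m powr dim * measure M (ball x s)"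
      using pos R by (intro ball_growth)
    finally have "C / measure M (ball x s) \<le> C * C0 * m powr dim / measure M (ball z \<rho>)"
      using ball_pos[of s x] ball_pos[of \<rho> z] pos
      by (simp add: field_simps)
    then have "C / measure M (ball x s) * exp (- (c * (dist x y)\<^sup>2 / t)) \<le>
        C * C0 * m powr dim / measure M (ball z \<rho>) * e"
      using e(2)[OF that] pos C0_ge_2 by (intro mult_mono) auto
    also have "\<dots> = (C * C0 * m powr dim * e) / measure M (ball z \<rho>)"
      by simp
    also have "\<dots> \<le> \<kappa>"
      unfolding \<kappa>_def using a by (intro divide_right_mono) auto
    finally show ?thesis .
  qed
  have "AE x in M. x \<in> A \<longrightarrow> norm (T (trunc Q f) x) \<le> \<kappa> * (LINT y:Q|M. norm (f y))"
    using rep K_int K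
  proof eventually_elim
    case (elim x)
    show ?case
    proof
      assume x: "x \<in> A"
      have "norm (T (trunc Q f) x) \<le> (LINT y|M. norm (K (x, y) * trunc Q f y))"
        unfolding elim(1) by (rule integral_norm_bound)
      also have "\<dots> \<le> (LINT y|M. \<kappa> * (indicator Q y *\<^sub>R norm (f y)))"
      proof (rule integral_mono_AE)
        show "AE y in M. norm (K (x, y) * trunc Q f y) \<le> \<kappa> * (indicator Q y *\<^sub>R norm (f y))"
          using elim(3)
        proof eventually_elim
          case (elim y)
          show ?case
          proof (cases "y \<in> Q")
            case True
            then have "norm (K (x, y)) \<le> \<kappa>"
              using elim kernel_le[OF x True] by linarith
            then show ?thesis
              using True by (simp add: trunc_def norm_mult mult_right_mono)
          qed (simp add: trunc_def)
        qed
      qed (use elim(2) fQ in auto)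
      finally show "norm (T (trunc Q f) x) \<le> \<kappa> * (LINT y:Q|M. norm (f y))"
        by (simp add: set_lebesgue_integral_def)
    qed
  qed
  then show ?thesis
    using avg_norm_infinity_le_iff[OF A Q T f ball_pos[OF pos(2)] a_nonneg]
    by (simp add: \<kappa>_def)
qed

text \<open>From \<open>j \<ge> 2\<close> the radius \<open>r\<close> is at most a quarter of
  \<open>2 ^ j * r\<close>, which leaves more than half of it after the triangle inequality.\<close>

lemma annulus_dist:
  assumes "x \<in> ball z r" "y \<in> annulus z r j" "j \<ge> 2"
  shows "2 ^ j * r / 2 \<le> dist x y"
proof -
  have "0 < r" using assms(1) by (metis dist_not_less_zero mem_ball not_less_iff_gr_or_eq order_less_trans zero_less_dist_iff dist_self)
  have "(2::real) ^ 2 \<le> 2 ^ j"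
    using assms(3) by (intro power_increasing) auto
  then have "4 * r \<le> 2 ^ j * r"
    using \<open>0 < r\<close> by (intro mult_right_mono) auto
  moreover have "2 ^ j * r \<le> dist z y" "dist z x < r"
    using assms by (auto simp: annulus_def)
  ultimately show ?thesis
    using dist_triangle[of z y x] \<open>0 < r\<close> by linarith
qed

lemma annulus_exp_le:
  assumes "2 ^ j * r / 2 \<le> dist x y" "0 < r" "0 < c" "0 < t"
  shows "exp (- (c * (dist x y)\<^sup>2 / t)) \<le> exp (- (c / 4 * 4 ^ j * r\<^sup>2 / t))"
proof -
  have "(2 ^ j * r / 2)\<^sup>2 \<le> (dist x y)\<^sup>2"
    using assms by (intro power_mono) auto
  moreover have "(2 ^ j * r / 2)\<^sup>2 = 4 ^ j * r\<^sup>2 / 4"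
    by (simp add: power_mult_distrib power_divide power2_eq_square flip: power_mult_distrib)
  ultimately have "c * (4 ^ j * r\<^sup>2 / 4) / t \<le> c * (dist x y)\<^sup>2 / t"
    using assms by (intro divide_right_mono mult_left_mono) auto
  then show ?thesis by (simp add: field_simps)
qed

lemma kernel_imp_off_diagonal:
  fixes D :: "('a \<Rightarrow> complex) set" and T :: "real \<Rightarrow> ('a \<Rightarrow> complex) \<Rightarrow> 'a \<Rightarrow> complex"
  assumes D_int: "D \<subseteq> {f. integrable M f}"
    and D: "truncation_stable_subspace M D"
    and T: "\<And>t. 0 < t \<Longrightarrow> linear_operator_on M D (T t)"
    and C: "0 < C" and c: "0 < c"
    and kernel: "\<And>t. 0 < t \<Longrightarrow> \<exists>K :: 'a \<times> 'a \<Rightarrow> complex.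
        K \<in> borel_measurable (M \<Otimes>\<^sub>M M) \<and>
        (\<forall>f. integrable M f \<longrightarrow>
           (AE x in M. integrable M (\<lambda>y. K (x, y) * f y)) \<and>
           (f \<in> D \<longrightarrow> (AE x in M. T t f x = (\<integral>y. K (x, y) * f y \<partial>M)))) \<and>
        (AE (x, y) in M \<Otimes>\<^sub>M M.
           norm (K (x, y)) \<le> C / measure M (ball x (sqrt t)) * exp (- (c * (dist x y)\<^sup>2 / t)))"
  shows "off_diagonal_on_balls M 1 \<infinity> D T"
proof -
  interpret MM: pair_sigma_finite M M ..
  have C0_eq: "2 powr dim = C0"
    using C0_ge_2 by (simp add: dim_def)
  have C0_4: "4 powr dim = C0 ^ 2"
    using powr_mult[of 2 2 dim] by (simp add: C0_eq power2_eq_square)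
  \<comment> \<open>The constants of the estimates: one factor \<open>C0\<close> comes from the
    rounding in \<open>ball_growth\<close> and two from \<open>4 powr dim\<close>; the rate
    \<open>c / 4\<close> comes from squaring half the distance \<open>2 ^ j * r\<close>. The
    exponents will be \<theta>2 = \<open>dim\<close> and \<theta>1 = 1, the latter a free choice as
    \<open>2 powr j\<close> only enlarges the right-hand side.\<close>
  have C_pos: "0 < C * C0 ^ 3"
    using C C0_ge_2 by simp
  have c_pos: "0 < c / 4"
    using c by simp
  show ?thesis
    unfolding off_diagonal_on_balls_def
  proof (rule exI[of _ "1::real"], rule conjI[OF zero_less_one], rule exI[of _ dim], rule conjI[OF dim_pos],
      rule exI[of _ "c / 4"], rule conjI[OF c_pos], rule exI[of _ "C * C0 ^ 3"], rule conjI[OF C_pos],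
      intro allI impI ballI conjI)
    fix t r :: real and z :: 'a and f
    assume t: "0 < t" and r: "0 < r" and f: "f \<in> D"
    from kernel[OF t] obtain K :: "'a \<times> 'a \<Rightarrow> complex" where
      K_rep: "\<And>f. f \<in> D \<Longrightarrow> AE x in M. T t f x = (\<integral>y. K (x, y) * f y \<partial>M)"
      and K_int: "\<And>f. f \<in> D \<Longrightarrow> AE x in M. integrable M (\<lambda>y. K (x, y) * f y)"
      and K_le: "AE (x, y) in M \<Otimes>\<^sub>M M.
           norm (K (x, y)) \<le> C / measure M (ball x (sqrt t)) * exp (- (c * (dist x y)\<^sup>2 / t))"
      using D_int by blast
    have K_AE: "AE x in M. AE y in M.
           norm (K (x, y)) \<le> C / measure M (ball x (sqrt t)) * exp (- (c * (dist x y)\<^sup>2 / t))"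
      using MM.AE_pair[OF K_le] by simp
    have tr: "trunc Q f \<in> D" if "Q \<in> sets M" for Q
      using D f that unfolding truncation_stable_subspace_def by blast
    have T_meas: "T t (trunc Q f) \<in> borel_measurable M" if "Q \<in> sets M" for Q
      using T[OF t] tr[OF that] unfolding linear_operator_on_def operator_on_def by blast
    have f_int: "integrable M f" using f D_int by auto
    have st: "0 < sqrt t" using t by simp
    have est: "avg_norm M \<infinity> E A (T t (trunc Q f)) \<le> ennreal a * avg_norm M 1 (ball w \<rho>) Q f"
      if A: "A \<in> sets M" and Q: "Q \<in> sets M" and \<rho>: "0 < \<rho>"
        and rest: "\<And>x. x \<in> A \<Longrightarrow> ball w \<rho> \<subseteq> ball x R" "1 \<le> m" "R \<le> m * sqrt t" "0 \<le> e"
          "\<And>x y. x \<in> A \<Longrightarrow> y \<in> Q \<Longrightarrow> exp (- (c * (dist x y)\<^sup>2 / t)) \<le> e"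
          "C * C0 * m powr dim * e \<le> a"
      for E A Q w \<rho> R m e a
      by (rule kernel_estimate[where T="T t" and K=K and f=f and Q=Q, OF f_int T_meas[OF Q] K_rep[OF tr[OF Q]] K_int[OF tr[OF Q]] K_AE A Q st \<rho> C rest])
    have \<Upsilon>1: "1 \<le> Upsilon (u / sqrt t)" and \<Upsilon>2: "u \<le> Upsilon (u / sqrt t) * sqrt t" if "0 < u" for u
      using Upsilon_ge[of "u / sqrt t"] st that by (auto simp: pos_divide_le_eq)
    show "avg_norm M \<infinity> (ball z r) (ball z r) (T t (trunc (ball z r) f))
          \<le> ennreal (C * C0 ^ 3 * Upsilon (r / sqrt t) powr dim) * avg_norm M 1 (ball z r) (ball z r) f"
    proof (rule est[where m="2 * Upsilon (r / sqrt t)" and R="2 * r" and e=1])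
      show "ball z r \<subseteq> ball x (2 * r)" if "x \<in> ball z r" for x
      proof
        fix y assume "y \<in> ball z r"
        then show "y \<in> ball x (2 * r)"
          using that dist_triangle3[of x y z] by simp
      qed
      \<comment> \<open>Recentring \<open>ball z r\<close> at one of its points doubles the radius,
        which costs \<open>2 powr dim = C0\<close>. The resulting square is enlarged to the cube
        needed for the annuli.\<close>
      have "C * C0 * (2 * Upsilon (r / sqrt t)) powr dim * 1 = C * C0 ^ 2 * Upsilon (r / sqrt t) powr dim"
        using \<Upsilon>1[OF r] by (simp add: powr_mult C0_eq power2_eq_square)
      also have "\<dots> \<le> C * C0 ^ 3 * Upsilon (r / sqrt t) powr dim"
        using C C0_ge_2 by (intro mult_right_mono mult_left_mono power_increasing) auto
      finally show "C * C0 * (2 * Upsilon (r / sqrt t)) powr dim * 1 \<le> C * C0 ^ 3 * Upsilon (r / sqrt t) powr dim" .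
    qed (use \<Upsilon>1[OF r] \<Upsilon>2[OF r] st r C c t in auto)
    fix j :: nat assume j: "2 \<le> j"
    have rj: "0 < 2 ^ j * r" using r by simp
    define e where "e = exp (- (c / 4 * 4 ^ j * r\<^sup>2 / t))"
    have a: "C * C0 * (4 * Upsilon (2 ^ j * r / sqrt t)) powr dim * e \<le>
        C * C0 ^ 3 * 2 powr (real j * 1) * Upsilon (2 ^ j * r / sqrt t) powr dim * e"
    proof -
      have "C * C0 * (4 * Upsilon (2 ^ j * r / sqrt t)) powr dim * e =
          C * C0 ^ 3 * 1 * Upsilon (2 ^ j * r / sqrt t) powr dim * e"
        using \<Upsilon>1[OF rj] by (simp add: powr_mult C0_4 power2_eq_square power3_eq_cube)
      also have "\<dots> \<le> C * C0 ^ 3 * 2 powr (real j * 1) * Upsilon (2 ^ j * r / sqrt t) powr dim * e"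
        using C C0_ge_2 by (intro mult_right_mono mult_left_mono) (auto simp: e_def ge_one_powr_ge_zero)
      finally show ?thesis .
    qed
    \<comment> \<open>Doubling the radius \<open>2 ^ (j + 1) * r\<close> gives
      \<open>4 * (2 ^ j * r)\<close>; this is the origin of the factor 4 in front of
      \<open>Upsilon\<close>.\<close>
    have sub: "ball z (2 ^ (j + 1) * r) \<subseteq> ball x (4 * (2 ^ j * r))" if "dist z x < 2 ^ (j + 1) * r" for x
    proof
      fix y assume "y \<in> ball z (2 ^ (j + 1) * r)"
      then show "y \<in> ball x (4 * (2 ^ j * r))"
        using that dist_triangle3[of x y z] by simp
    qed
    have r_le: "r \<le> 2 ^ (j + 1) * r"
      using mult_right_mono[OF one_le_power[of "2::real" "j + 1"], of r] r by simp
    show "avg_norm M \<infinity> (ball z r) (ball z r) (T t (trunc (annulus z r j) f))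
        \<le> ennreal (C * C0 ^ 3 * 2 powr (real j * 1) * Upsilon (2 ^ j * r / sqrt t) powr dim *
            exp (- (c / 4 * 4 ^ j * r\<^sup>2 / t))) * avg_norm M 1 (ball z (2 ^ (j + 1) * r)) (annulus z r j) f"
    proof (rule est[where R="4 * (2 ^ j * r)" and m="4 * Upsilon (2 ^ j * r / sqrt t)" and e=e])
      show "C * C0 * (4 * Upsilon (2 ^ j * r / sqrt t)) powr dim * e
        \<le> C * C0 ^ 3 * 2 powr (real j * 1) * Upsilon (2 ^ j * r / sqrt t) powr dim * exp (- (c / 4 * 4 ^ j * r\<^sup>2 / t))"
        using a by (simp add: e_def)
      show "ball z (2 ^ (j + 1) * r) \<subseteq> ball x (4 * (2 ^ j * r))" if "x \<in> ball z r" for x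
        using that r_le by (intro sub) auto
      show "exp (- (c * (dist x y)\<^sup>2 / t)) \<le> e"
        if "x \<in> ball z r" "y \<in> annulus z r j" for x y
        using annulus_dist[OF that j] r c t unfolding e_def by (rule annulus_exp_le)
    qed (use \<Upsilon>1[OF rj] \<Upsilon>2[OF rj] r in \<open>auto simp: e_def\<close>)
    show "avg_norm M \<infinity> (ball z (2 ^ (j + 1) * r)) (annulus z r j) (T t (trunc (ball z r) f))
        \<le> ennreal (C * C0 ^ 3 * 2 powr (real j * 1) * Upsilon (2 ^ j * r / sqrt t) powr dim *
            exp (- (c / 4 * 4 ^ j * r\<^sup>2 / t))) * avg_norm M 1 (ball z r) (ball z r) f"
    proof (rule est[where R="4 * (2 ^ j * r)" and m="4 * Upsilon (2 ^ j * r / sqrt t)" and e=e])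
      show "C * C0 * (4 * Upsilon (2 ^ j * r / sqrt t)) powr dim * e
        \<le> C * C0 ^ 3 * 2 powr (real j * 1) * Upsilon (2 ^ j * r / sqrt t) powr dim * exp (- (c / 4 * 4 ^ j * r\<^sup>2 / t))"
        using a by (simp add: e_def)
      show "ball z r \<subseteq> ball x (4 * (2 ^ j * r))" if "x \<in> annulus z r j" for x
        using that subset_ball[OF r_le, of z] sub[of x] by (auto simp: annulus_def)
      show "exp (- (c * (dist x y)\<^sup>2 / t)) \<le> e"
        if "x \<in> annulus z r j" "y \<in> ball z r" for x y
        using annulus_dist[OF that(2,1) j] r c t unfolding e_def by (subst dist_commute) (rule annulus_exp_le)
    qed (use \<Upsilon>1[OF rj] \<Upsilon>2[OF rj] r in \<open>auto simp: e_def\<close>)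
  qed
qed

end

text \<open>Serves to absorb the powers of \<open>2 ^ j\<close> into part of the exponential decay.
  It rests on the inequality between \<open>(1 + x / n) ^ n\<close> and \<open>exp x\<close> at
  \<open>x = b * z\<^sup>2\<close>.\<close>

lemma powr_mult_exp_bounded:
  fixes \<theta> b :: real
  assumes "0 < b"
  shows "\<exists>B>0. \<forall>z\<ge>1. z powr \<theta> * exp (- (b * z\<^sup>2)) \<le> B"
proof -
  define n where "n = Suc (nat \<lceil>\<theta>\<rceil>)"
  have n: "\<theta> \<le> real n" "0 < n" unfolding n_def by linarith+
  have "z powr \<theta> * exp (- (b * z\<^sup>2)) \<le> (real n / b) ^ n" if z: "1 \<le> z" for z
  proof -
    have "z powr \<theta> \<le> z powr real n"
      using n z by (intro powr_mono) auto
    also have "\<dots> = z ^ n" using z by (simp add: powr_realpow)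
    also have "\<dots> \<le> (z\<^sup>2) ^ n"
      using z by (intro power_mono) (auto simp: power2_eq_square mult_le_cancel_left1)
    also have "(z\<^sup>2) ^ n = (real n / b) ^ n * (b * z\<^sup>2 / real n) ^ n"
      using assms n by (simp flip: power_mult_distrib)
    also have "\<dots> \<le> (real n / b) ^ n * exp (b * z\<^sup>2)"
    proof (intro mult_left_mono)
      have "(b * z\<^sup>2 / real n) ^ n \<le> (1 + b * z\<^sup>2 / real n) ^ n"
        using assms by (intro power_mono) auto
      also have "\<dots> \<le> exp (b * z\<^sup>2)"
      proof (rule exp_ge_one_plus_x_over_n_power_n)
        have "0 \<le> b * z\<^sup>2" using assms by simp
        then show "- real n \<le> b * z\<^sup>2" by linarith
      qed (rule n)
      finally show "(b * z\<^sup>2 / real n) ^ n \<le> exp (b * z\<^sup>2)" .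
    qed (use assms in simp)
    finally show ?thesis
      by (simp add: exp_minus field_simps)
  qed
  moreover have "0 < (real n / b) ^ n" using assms n by simp
  ultimately show ?thesis by blast
qed

text \<open>Where \<open>norm (g x)\<close> exceeds \<open>b + \<epsilon>\<close>, each
  \<open>G n\<close> differs from \<open>g\<close> by more than \<open>\<epsilon>\<close> up to a
  null set. The measure of the latter set tends to 0, so no subsequence has to be extracted.\<close>

lemma (in sigma_finite_measure) AE_norm_le_of_measure_limit:
  fixes g :: "'a \<Rightarrow> 'b::{real_normed_vector, second_countable_topology}"
  assumes g [measurable]: "g \<in> borel_measurable M" "\<And>n. G n \<in> borel_measurable M"
    and P [measurable]: "P \<in> sets M" and P_fin: "emeasure M P \<noteq> \<infinity>"
    and lim: "\<And>\<epsilon>. 0 < \<epsilon> \<Longrightarrow> (\<lambda>n::nat. measure M {x\<in>P. \<epsilon> < norm (G n x - g x)}) \<longlonglongrightarrow> 0"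
    and le: "\<And>n. AE x in M. x \<in> P \<longrightarrow> norm (G n x) \<le> b"
  shows "AE x in M. x \<in> P \<longrightarrow> norm (g x) \<le> b"
proof -
  have "AE x in M. x \<in> P \<longrightarrow> norm (g x) \<le> b + \<epsilon>" if \<epsilon>: "0 < \<epsilon>" for \<epsilon>
  proof -
    have "P \<in> fmeasurable M"
      using P P_fin by (simp add: fmeasurable_def less_top)
    then have fin: "A \<in> fmeasurable M" if "A \<in> sets M" "A \<subseteq> P" for A
      using that fmeasurableI2 by blast
    have set_eq: "{x\<in>P. Q x} = P \<inter> {x\<in>space M. Q x}" for Q
      using sets.sets_into_space[OF P] by auto
    have E [measurable]: "{x\<in>P. \<epsilon> < norm (G n x - g x)} \<in> sets M" for n
      unfolding set_eq by measurable
    have N [measurable]: "{x\<in>P. b + \<epsilon> < norm (g x)} \<in> sets M"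
      unfolding set_eq by measurable
    have "measure M {x\<in>P. b + \<epsilon> < norm (g x)} \<le> measure M {x\<in>P. \<epsilon> < norm (G n x - g x)}" for n
    proof -
      have "AE x in M. x \<in> {x\<in>P. b + \<epsilon> < norm (g x)} \<longrightarrow> x \<in> {x\<in>P. \<epsilon> < norm (G n x - g x)}"
        using le[of n]
      proof eventually_elim
        case (elim x)
        then show ?case
          using norm_triangle_sub[of "g x" "G n x"] by (auto simp: norm_minus_commute)
      qed
      then have "emeasure M {x\<in>P. b + \<epsilon> < norm (g x)} \<le> emeasure M {x\<in>P. \<epsilon> < norm (G n x - g x)}"
        by (rule emeasure_mono_AE) (rule E)
      then show ?thesis
        using fin[OF E[of n]] unfolding measure_def
        by (intro enn2real_mono) (auto simp: fmeasurable_def)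
    qed
    then have "measure M {x\<in>P. b + \<epsilon> < norm (g x)} \<le> 0"
      by (intro LIMSEQ_le_const[OF lim[OF \<epsilon>]]) auto
    then have "measure M {x\<in>P. b + \<epsilon> < norm (g x)} = 0"
      by (simp add: order_antisym)
    moreover have "{x\<in>P. b + \<epsilon> < norm (g x)} \<in> fmeasurable M"
      using N by (rule fin) auto
    ultimately have "emeasure M {x\<in>P. b + \<epsilon> < norm (g x)} = 0"
      by (simp add: emeasure_eq_measure2)
    then have "{x\<in>P. b + \<epsilon> < norm (g x)} \<in> null_sets M"
      using N by (simp add: null_sets_def)
    from AE_not_in[OF this] show ?thesis
      by eventually_elim auto
  qed
  then have "AE x in M. \<forall>m. x \<in> P \<longrightarrow> norm (g x) \<le> b + 1 / real (Suc m)"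
    by (subst AE_all_countable) auto
  then show ?thesis
  proof eventually_elim
    case (elim x)
    have "(\<lambda>m. b + 1 / real (Suc m)) \<longlonglongrightarrow> b + 0"
      using LIMSEQ_inverse_real_of_nat by (intro tendsto_intros) (simp add: inverse_eq_divide)
    then show ?case
      using elim by (auto intro: LIMSEQ_le_const)
  qed
qed

section \<open>The estimates imply domination and a kernel\<close>

context doubling_measure
begin

text \<open>The annuli start at \<open>j = 2\<close>, so the core left uncovered is
  \<open>ball z (4 * s)\<close>; the diagonal estimate is applied there and restricted to
  \<open>ball z s\<close>. Finitely many pieces handle bounded support, and
  \<open>determined_by_truncations\<close> passes to general \<open>f\<close>. The weight
  \<open>w\<close> is abstract: it only has to exceed the normalised constant of each piece.\<close>

lemma off_diagonal_local_bound:
  fixes D :: "('a \<Rightarrow> complex) set" and S :: "('a \<Rightarrow> complex) \<Rightarrow> 'a \<Rightarrow> complex"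
  assumes D_int: "D \<subseteq> {f. integrable M f}"
    and D: "truncation_stable_subspace M D"
    and S: "linear_operator_on M D S"
    and S_det: "determined_by_truncations M D S"
    and s: "0 < s"
    and w: "w \<in> borel_measurable M" "\<And>y. 0 \<le> w y" "\<And>y. w y \<le> b"
    and a0: "0 \<le> a0" "\<And>y. y \<in> ball z (4 * s) \<Longrightarrow> a0 / measure M (ball z (4 * s)) \<le> w y"
    and est0: "\<And>f. f \<in> D \<Longrightarrow> avg_norm M \<infinity> (ball z (4 * s)) (ball z (4 * s)) (S (trunc (ball z (4 * s)) f))
      \<le> ennreal a0 * avg_norm M 1 (ball z (4 * s)) (ball z (4 * s)) f"
    and a: "\<And>j. 2 \<le> j \<Longrightarrow> 0 \<le> a j"
      "\<And>j y. 2 \<le> j \<Longrightarrow> y \<in> annulus z s j \<Longrightarrow> a j / measure M (ball z (2 ^ (j + 1) * s)) \<le> w y"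
    and est: "\<And>f j. f \<in> D \<Longrightarrow> 2 \<le> j \<Longrightarrow> avg_norm M \<infinity> (ball z s) (ball z s) (S (trunc (annulus z s j) f))
      \<le> ennreal (a j) * avg_norm M 1 (ball z (2 ^ (j + 1) * s)) (annulus z s j) f"
    and f: "f \<in> D"
  shows "AE x in M. x \<in> ball z s \<longrightarrow> norm (S f x) \<le> (LINT y|M. w y * norm (f y))"
proof -
  have tr: "trunc Q f \<in> D" if "Q \<in> sets M" "f \<in> D" for Q f
    using D that unfolding truncation_stable_subspace_def by blast
  have S_meas: "S f \<in> borel_measurable M" if "f \<in> D" for f
    using S that unfolding linear_operator_on_def operator_on_def by blast
  have f_int: "integrable M f" if "f \<in> D" for f
    using that D_int by auto
  have wf_int: "integrable M (\<lambda>y. w y * norm (f y))" if "f \<in> D" for f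
  proof (rule Bochner_Integration.integrable_bound[of M "\<lambda>y. b * norm (f y)"])
    show "AE y in M. norm (w y * norm (f y)) \<le> norm (b * norm (f y))"
    proof (rule AE_I2)
      fix y
      have "\<bar>w y\<bar> \<le> \<bar>b\<bar>" using w(2)[of y] w(3)[of y] by linarith
      then show "norm (w y * norm (f y)) \<le> norm (b * norm (f y))"
        by (simp add: abs_mult mult_right_mono)
    qed
    have "f \<in> borel_measurable M" using f_int[OF that] by auto
    then show "(\<lambda>y. w y * norm (f y)) \<in> borel_measurable M"
      using w(1) by measurable
  qed (use f_int[OF that] in simp)
  have wf_set: "set_integrable M Q (\<lambda>y. w y * norm (f y))" if "Q \<in> sets M" "f \<in> D" for Q f
    unfolding set_integrable_def using that wf_int by (intro integrable_mult_indicator)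
  have piece: "AE x in M. x \<in> A \<longrightarrow> norm (S (trunc Q f) x) \<le> (LINT y:Q|M. w y * norm (f y))"
    if "f \<in> D" and A: "A \<in> sets M" and Q: "Q \<in> sets M" and k: "0 \<le> k" "0 < measure M E" "\<And>y. y \<in> Q \<Longrightarrow> k / measure M E \<le> w y"
      and avg: "avg_norm M \<infinity> E' A (S (trunc Q f)) \<le> ennreal k * avg_norm M 1 E Q f" for f A Q k E E'
  proof -
    have "AE x in M. x \<in> A \<longrightarrow> norm (S (trunc Q f) x) \<le> k / measure M E * (LINT x:Q|M. norm (f x))"
      using avg avg_norm_infinity_le_iff[OF A Q S_meas[OF tr[OF Q \<open>f \<in> D\<close>]] f_int[OF \<open>f \<in> D\<close>] k(2,1)]
      by simp
    moreover have int_le: "k / measure M E * (LINT x:Q|M. norm (f x)) \<le> (LINT y:Q|M. w y * norm (f y))"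
    proof -
      have fQ: "set_integrable M Q (\<lambda>x. norm (f x))"
        unfolding set_integrable_def using Q f_int[OF \<open>f \<in> D\<close>] by (intro integrable_mult_indicator) auto
      have "k / measure M E * (LINT x:Q|M. norm (f x)) = (LINT x:Q|M. k / measure M E * norm (f x))"
        by simp
      also have "\<dots> \<le> (LINT y:Q|M. w y * norm (f y))"
      proof (rule set_integral_mono)
        show "set_integrable M Q (\<lambda>x. k / measure M E * norm (f x))"
          using fQ by simp
        show "k / measure M E * norm (f x) \<le> w x * norm (f x)" if "x \<in> Q" for x
          using k(3)[OF that] by (rule mult_right_mono) simp
      qed (rule wf_set[OF Q \<open>f \<in> D\<close>])
      finally show ?thesis .
    qed
    ultimately show ?thesis
      by eventually_elim (metis int_le order_trans)
  qed
  \<comment> \<open>The shift by 2 makes the induction start at the core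
    \<open>ball z (4 * s)\<close>; each step adds the annulus with index
    \<open>n + 2\<close>.\<close>
  have ball_bound: "AE x in M. x \<in> ball z s \<longrightarrow> norm (S (trunc (ball z (2 ^ (n + 2) * s)) f) x)
      \<le> (LINT y:ball z (2 ^ (n + 2) * s)|M. w y * norm (f y))" if fD: "f \<in> D" for f n
  proof (induction n)
    case 0
    have "AE x in M. x \<in> ball z (4 * s) \<longrightarrow> norm (S (trunc (ball z (4 * s)) f) x)
      \<le> (LINT y:ball z (4 * s)|M. w y * norm (f y))"
      using fD a0 est0[OF fD] ball_pos[of "4 * s" z] s by (intro piece) auto
    then show ?case
      using s by (auto elim!: eventually_mono)
  next
    case (Suc n)
    let ?B = "ball z (2 ^ (n + 2) * s)" and ?A = "annulus z s (n + 2)"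
    have le: "2 ^ (n + 2) * s \<le> 2 ^ (n + 3) * s"
      using s by (simp add: power_add)
    have un: "ball z (2 ^ (Suc n + 2) * s) = ?B \<union> ?A" and dj: "?B \<inter> ?A = {}"
      unfolding annulus_def using subset_ball[OF le, of z] by (auto simp: numeral_eq_Suc)
    have "trunc (?B \<union> ?A) f = (\<lambda>y. trunc ?B f y + trunc ?A f y)"
      using dj by (auto simp: trunc_def indicator_def fun_eq_iff)
    then have "AE x in M. S (trunc (?B \<union> ?A) f) x = S (trunc ?B f) x + S (trunc ?A f) x"
      using S tr[of ?B, OF _ fD] tr[of ?A, OF _ fD] unfolding linear_operator_on_def by simp
    moreover have "AE x in M. x \<in> ball z s \<longrightarrow> norm (S (trunc ?A f) x) \<le> (LINT y:?A|M. w y * norm (f y))"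
      using fD s a[of "n + 2"] est[OF fD, of "n + 2"] ball_pos[of "2 ^ (n + 2 + 1) * s" z] by (intro piece) auto
    moreover have int_Un: "(LINT y:?B \<union> ?A|M. w y * norm (f y)) =
        (LINT y:?B|M. w y * norm (f y)) + (LINT y:?A|M. w y * norm (f y))"
      using dj fD by (intro set_integral_Un wf_set) auto
    ultimately show ?case
      unfolding un int_Un using Suc
      by eventually_elim (simp add: norm_triangle_mono)
  qed
  show ?thesis
  proof (rule AE_norm_le_of_measure_limit[where G="\<lambda>n. S (trunc (ball z (real n)) f)"])
    show "(\<lambda>n. measure M {x \<in> ball z s. \<epsilon> < norm (S (trunc (ball z (real n)) f) x - S f x)}) \<longlonglongrightarrow> 0"
      if "0 < \<epsilon>" for \<epsilon>
      using S_det f s that unfolding determined_by_truncations_def by blast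
    fix n :: nat
    let ?f = "trunc (ball z (real n)) f"
    have fD: "?f \<in> D" using f by (intro tr) auto
    \<comment> \<open>A dyadic ball containing \<open>ball z (real n)\<close>: truncating
      \<open>?f\<close> to it changes nothing, so the dyadic bound applies with a right-hand side
      independent of \<open>n\<close>.\<close>
    obtain k where "real n / s < 2 ^ k"
      using real_arch_pow[of 2 "real n / s"] by auto
    also have "(2::real) ^ k \<le> 2 ^ (k + 2)" by simp
    finally have "real n \<le> 2 ^ (k + 2) * s"
      using s by (simp add: field_simps)
    then have "trunc (ball z (2 ^ (k + 2) * s)) ?f = ?f"
      by (auto simp: trunc_def indicator_def fun_eq_iff)
    moreover have "(LINT y:ball z (2 ^ (k + 2) * s)|M. w y * norm (?f y)) \<le> (LINT y|M. w y * norm (f y))"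
      unfolding set_lebesgue_integral_def
    proof (rule integral_mono)
      show "integrable M (\<lambda>y. indicator (ball z (2 ^ (k + 2) * s)) y *\<^sub>R (w y * norm (?f y)))"
        using wf_set[OF _ fD] by (simp add: set_integrable_def)
    qed (use wf_int[OF f] w(2) in \<open>auto simp: trunc_def indicator_def\<close>)
    ultimately show "AE x in M. x \<in> ball z s \<longrightarrow> norm (S ?f x) \<le> (LINT y|M. w y * norm (f y))"
      using ball_bound[OF fD, of k] by (auto elim!: eventually_mono)
  qed (use f ball_finite S_meas tr in auto)
qed

lemma off_diagonal_imp_kernel:
  fixes D :: "('a \<Rightarrow> complex) set" and T :: "real \<Rightarrow> ('a \<Rightarrow> complex) \<Rightarrow> 'a \<Rightarrow> complex"
  assumes D_int: "D \<subseteq> {f. integrable M f}"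
    and D: "truncation_stable_subspace M D"
    and T: "\<And>t. 0 < t \<Longrightarrow> linear_operator_on M D (T t)"
    and T_det: "\<And>t. 0 < t \<Longrightarrow> determined_by_truncations M D (T t)"
    and off: "off_diagonal_on_balls M 1 \<infinity> D T"
  shows "\<exists>C>0. \<exists>c>0. \<forall>t>0. \<exists>K :: 'a \<times> 'a \<Rightarrow> complex.
        K \<in> borel_measurable (M \<Otimes>\<^sub>M M) \<and>
        (\<forall>f. integrable M f \<longrightarrow>
           (AE x in M. integrable M (\<lambda>y. K (x, y) * f y)) \<and>
           (f \<in> D \<longrightarrow> (AE x in M. T t f x = (\<integral>y. K (x, y) * f y \<partial>M)))) \<and>
        (AE (x, y) in M \<Otimes>\<^sub>M M.
           norm (K (x, y)) \<le> C / measure M (ball x (sqrt t)) * exp (- (c * (dist x y)\<^sup>2 / t)))"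
proof -
  obtain \<theta>1 \<theta>2 c C where pos: "0 < \<theta>1" "0 < \<theta>2" "0 < c" "0 < C" and
    est: "\<forall>t>0. \<forall>x. \<forall>r>0. \<forall>f\<in>D.
        avg_norm M \<infinity> (ball x r) (ball x r) (T t (trunc (ball x r) f))
          \<le> ennreal (C * Upsilon (r / sqrt t) powr \<theta>2) * avg_norm M 1 (ball x r) (ball x r) f \<and>
        (\<forall>j\<ge>2.
          avg_norm M \<infinity> (ball x r) (ball x r) (T t (trunc (annulus x r j) f))
            \<le> ennreal (C * 2 powr (real j * \<theta>1) * Upsilon (2 ^ j * r / sqrt t) powr \<theta>2
                  * exp (- (c * 4 ^ j * r\<^sup>2 / t)))
              * avg_norm M 1 (ball x (2 ^ (j + 1) * r)) (annulus x r j) f \<and>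
          avg_norm M \<infinity> (ball x (2 ^ (j + 1) * r)) (annulus x r j) (T t (trunc (ball x r) f))
            \<le> ennreal (C * 2 powr (real j * \<theta>1) * Upsilon (2 ^ j * r / sqrt t) powr \<theta>2
                  * exp (- (c * 4 ^ j * r\<^sup>2 / t)))
              * avg_norm M 1 (ball x r) (ball x r) f)"
    using off unfolding off_diagonal_on_balls_def by (elim exE conjE) (rule that)
  \<comment> \<open>Half of the rate \<open>c\<close> is spent on the powers with exponents
    \<theta>1 and \<theta>2, at \<open>z = 2 ^ j\<close>; the other half remains as decay.\<close>
  obtain B1 where B1: "0 < B1" "\<And>z. 1 \<le> z \<Longrightarrow> z powr (\<theta>1 + \<theta>2) * exp (- (c / 2 * z\<^sup>2)) \<le> B1"
    using powr_mult_exp_bounded[of "c / 2" "\<theta>1 + \<theta>2"] pos by auto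
  \<comment> \<open>The first summand serves the annuli. The second serves the core: there the
    distance is below \<open>4 * s\<close>, and the Gaussian of rate \<open>c / 8\<close> is at
    least \<open>exp (- (2 * c))\<close>.\<close>
  define B where "B = C * B1 + C * 4 powr \<theta>2 * exp (2 * c)"
  have B: "0 < B"
    unfolding B_def using pos B1 by (intro add_pos_pos mult_pos_pos) auto
  \<comment> \<open>The factor 2 comes from the kernel theorem. Moving the centre from the net point
    to \<open>x\<close> costs \<open>C0\<close> for the measure of the ball and
    \<open>exp (c / 8)\<close> for the Gaussian, whose rate is halved to
    \<open>c / 16\<close>.\<close>
  define C' where "C' = 2 * B * C0 * exp (c / 8)"
  have C': "0 < C'" unfolding C'_def using B C0_ge_2 by simp
  have "\<exists>K :: 'a \<times> 'a \<Rightarrow> complex.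
        K \<in> borel_measurable (M \<Otimes>\<^sub>M M) \<and>
        (\<forall>f. integrable M f \<longrightarrow>
           (AE x in M. integrable M (\<lambda>y. K (x, y) * f y)) \<and>
           (f \<in> D \<longrightarrow> (AE x in M. T t f x = (\<integral>y. K (x, y) * f y \<partial>M)))) \<and>
        (AE (x, y) in M \<Otimes>\<^sub>M M.
           norm (K (x, y)) \<le> C' / measure M (ball x (sqrt t)) * exp (- (c / 16 * (dist x y)\<^sup>2 / t)))"
    if t: "0 < t" for t
  proof -
    \<comment> \<open>At this radius \<open>Upsilon (2 ^ j * s / sqrt t)\<close> is just
      \<open>2 ^ j\<close>.\<close>
    define s where "s = sqrt t"
    have s: "0 < s" and s2: "s\<^sup>2 = t" using t by (auto simp: s_def)
    obtain X :: "nat \<Rightarrow> 'a" where X: "\<And>y. \<exists>i. dist (X i) y < s"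
      using ex_countable_net[OF s] by blast
    \<comment> \<open>The first net point near \<open>x\<close> is a measurable choice with
      countably many values, which makes \<open>W\<close> jointly measurable.\<close>
    define i where "i x = (LEAST i. dist (X i) x < s)" for x
    have i: "dist (X (i x)) x < s" for x
      unfolding i_def using X by (rule LeastI_ex)
    \<comment> \<open>The rate \<open>c / 8\<close>: of the remaining \<open>c / 2\<close> a quarter
      is left, because on the annulus \<open>j\<close> the distance may reach twice
      \<open>2 ^ j * s\<close>.\<close>
    define w where "w n y = B / measure M (ball (X n) s) * exp (- (c / 8 * (dist (X n) y)\<^sup>2 / t))" for n y
    define W where "W z = w (i (fst z)) (snd z)" for z
    have [measurable]: "(\<lambda>y. dist (X n) y) \<in> borel_measurable M" for n
      unfolding measurable_cong_sets[OF sets_eq_borel refl]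
      by (intro borel_measurable_continuous_onI continuous_intros)
    have w_meas [measurable]: "w n \<in> borel_measurable M" for n
      unfolding w_def by measurable
    have w_nonneg: "0 \<le> w n y" for n y
      unfolding w_def using B by simp
    have w_le: "w n y \<le> B / measure M (ball (X n) s)" for n y
    proof -
      have "0 \<le> c / 8 * (dist (X n) y)\<^sup>2 / t" using pos t by simp
      then have "exp (- (c / 8 * (dist (X n) y)\<^sup>2 / t)) \<le> 1" by simp
      then show ?thesis
        unfolding w_def using B by (intro mult_right_le_one_le) auto
    qed
    have [measurable]: "i \<in> measurable M (count_space UNIV)"
      unfolding i_def by measurable
    have W_meas: "W \<in> borel_measurable (M \<Otimes>\<^sub>M M)"
      unfolding W_def by (rule measurable_compose_countable[where g="\<lambda>z. i (fst z)"]) measurable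
    have local_bound: "AE x in M. x \<in> ball (X n) s \<longrightarrow> norm (T t f x) \<le> (LINT y|M. w n y * norm (f y))"
      if f: "f \<in> D" for n f
    proof (rule off_diagonal_local_bound[OF D_int D T[OF t] T_det[OF t] s w_meas w_nonneg w_le])
      let ?u = "C * Upsilon (4 * s / sqrt t) powr \<theta>2"
      let ?a = "\<lambda>j. C * 2 powr (real j * \<theta>1) * Upsilon (2 ^ j * s / sqrt t) powr \<theta>2 * exp (- (c * 4 ^ j * s\<^sup>2 / t))"
      show "avg_norm M \<infinity> (ball (X n) (4 * s)) (ball (X n) (4 * s)) (T t (trunc (ball (X n) (4 * s)) f))
        \<le> ennreal ?u * avg_norm M 1 (ball (X n) (4 * s)) (ball (X n) (4 * s)) f" if "f \<in> D" for f
        using est t s that by simp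
      show "avg_norm M \<infinity> (ball (X n) s) (ball (X n) s) (T t (trunc (annulus (X n) s j) f))
        \<le> ennreal (?a j) * avg_norm M 1 (ball (X n) (2 ^ (j + 1) * s)) (annulus (X n) s j) f"
        if "f \<in> D" "2 \<le> j" for f j
        using est t s that by blast
      show "0 \<le> ?u" "0 \<le> ?a j" for j
        using pos by auto
      show "?u / measure M (ball (X n) (4 * s)) \<le> w n y" if "y \<in> ball (X n) (4 * s)" for y
      proof -
        have "?u = C * 4 powr \<theta>2"
          using s by (simp add: s_def Upsilon_def)
        also have "\<dots> = C * 4 powr \<theta>2 * exp (2 * c) * exp (- (2 * c))"
          by (simp add: exp_minus)
        also have "\<dots> \<le> B * exp (- (c / 8 * (dist (X n) y)\<^sup>2 / t))"
        proof (intro mult_mono)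
          show "C * 4 powr \<theta>2 * exp (2 * c) \<le> B"
            unfolding B_def using pos B1 by simp
          have "(dist (X n) y)\<^sup>2 \<le> (4 * s)\<^sup>2"
            using that by (intro power_mono) auto
          then have "c / 8 * (dist (X n) y)\<^sup>2 / t \<le> c / 8 * (4 * s)\<^sup>2 / t"
            using pos t by (intro divide_right_mono mult_left_mono) auto
          also have "\<dots> = 2 * c"
            using t by (simp add: power_mult_distrib s2)
          finally show "exp (- (2 * c)) \<le> exp (- (c / 8 * (dist (X n) y)\<^sup>2 / t))" by simp
        qed (use B in auto)
        finally have "?u / measure M (ball (X n) (4 * s)) \<le>
            B * exp (- (c / 8 * (dist (X n) y)\<^sup>2 / t)) / measure M (ball (X n) s)"
          using s pos B ball_pos[OF s] by (intro frac_le ball_mono subset_ball) auto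
        then show ?thesis by (simp add: w_def)
      qed
      show "?a j / measure M (ball (X n) (2 ^ (j + 1) * s)) \<le> w n y"
        if j: "2 \<le> j" and y: "y \<in> annulus (X n) s j" for j y
      proof -
        have z: "(1::real) \<le> 2 ^ j" by simp
        have sq: "((2::real) ^ j)\<^sup>2 = 4 ^ j"
          by (simp add: power2_eq_square flip: power_mult_distrib)
        have "1 / (2::real) ^ j \<le> 1" by simp
        then have U: "Upsilon (2 ^ j * s / sqrt t) = 2 ^ j"
          using s z by (simp add: s_def Upsilon_def max_absorb1 order_trans[OF _ z])
        have "c * 4 ^ j * s\<^sup>2 / t = c / 2 * 4 ^ j + c / 2 * 4 ^ j"
          using t by (simp add: s2)
        then have "?a j = C * ((2 ^ j) powr (\<theta>1 + \<theta>2) * exp (- (c / 2 * (2 ^ j)\<^sup>2))) * exp (- (c / 2 * 4 ^ j))"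
          by (simp only: U sq powr_add minus_add_distrib exp_add powr_powr[symmetric])
            (simp add: powr_powr[symmetric] powr_realpow)
        also have "\<dots> \<le> B * exp (- (c / 8 * (dist (X n) y)\<^sup>2 / t))"
        proof (intro mult_mono)
          have "C * ((2 ^ j) powr (\<theta>1 + \<theta>2) * exp (- (c / 2 * (2 ^ j)\<^sup>2))) \<le> C * B1"
            using B1(2)[OF z] pos by (intro mult_left_mono) auto
          also have "\<dots> \<le> B" unfolding B_def using pos by simp
          finally show "C * ((2 ^ j) powr (\<theta>1 + \<theta>2) * exp (- (c / 2 * (2 ^ j)\<^sup>2))) \<le> B" .
          have "(dist (X n) y)\<^sup>2 \<le> (2 * 2 ^ j * s)\<^sup>2"
            using y by (intro power_mono) (auto simp: annulus_def)
          then have "c / 8 * (dist (X n) y)\<^sup>2 / t \<le> c / 8 * (2 * 2 ^ j * s)\<^sup>2 / t"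
            using pos t by (intro divide_right_mono mult_left_mono) auto
          also have "\<dots> = c / 2 * 4 ^ j"
            using t by (simp add: power_mult_distrib s2 sq)
          finally show "exp (- (c / 2 * 4 ^ j)) \<le> exp (- (c / 8 * (dist (X n) y)\<^sup>2 / t))" by simp
        qed (use B in auto)
        finally have "?a j / measure M (ball (X n) (2 ^ (j + 1) * s)) \<le>
            B * exp (- (c / 8 * (dist (X n) y)\<^sup>2 / t)) / measure M (ball (X n) s)"
        proof (intro frac_le ball_mono subset_ball)
          show "s \<le> 2 ^ (j + 1) * s"
            using mult_right_mono[OF one_le_power[of "2::real" "j + 1"], of s] s by simp
        qed (use B ball_pos[OF s] in auto)
        then show ?thesis by (simp add: w_def)
      qed
    qed (rule f)
    interpret dominated_operator M D "T t" W
    proof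
      show "AE x in M. norm (T t f x) \<le> (LINT y|M. W (x, y) * norm (f y))" if "f \<in> D" for f
      proof -
        \<comment> \<open>Countability of the net gives one null set valid for all local bounds, so
          the index may afterwards depend on \<open>x\<close>.\<close>
        have "AE x in M. \<forall>n. x \<in> ball (X n) s \<longrightarrow> norm (T t f x) \<le> (LINT y|M. w n y * norm (f y))"
          using local_bound[OF that] by (subst AE_all_countable) auto
        then show ?thesis
          by eventually_elim (use i in \<open>auto simp: W_def\<close>)
      qed
      show "\<exists>b. \<forall>y. W (x, y) \<le> b" for x
        using w_le by (auto simp: W_def)
    qed (use D_int D T[OF t] W_meas w_nonneg in \<open>auto simp: W_def\<close>)
    obtain K where K: "K \<in> borel_measurable (M \<Otimes>\<^sub>M M)" "\<And>z. norm (K z) \<le> 2 * W z"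
      "\<And>f. f \<in> D \<Longrightarrow> AE x in M. T t f x = (LINT y|M. K (x, y) * f y)"
      using ex_kernel by blast
    have "norm (K (x, y)) \<le> C' / measure M (ball x (sqrt t)) * exp (- (c / 16 * (dist x y)\<^sup>2 / t))" for x y
    proof -
      let ?d = "dist (X (i x)) y"
      have "dist x y \<le> ?d + s"
        using dist_triangle3[of x y "X (i x)"] i[of x] by simp
      then have "(dist x y)\<^sup>2 \<le> (?d + s)\<^sup>2"
        by (intro power_mono) auto
      also have "\<dots> \<le> 2 * ?d\<^sup>2 + 2 * s\<^sup>2"
        using zero_le_power2[of "?d - s"] by (simp add: power2_eq_square algebra_simps)
      finally have "c / 16 * (dist x y)\<^sup>2 / t \<le> c / 16 * (2 * ?d\<^sup>2 + 2 * s\<^sup>2) / t"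
        using pos t by (intro divide_right_mono mult_left_mono) auto
      also have "\<dots> = c / 8 * ?d\<^sup>2 / t + c / 8"
        using t by (simp add: s2 field_simps)
      finally have e: "exp (- (c / 8 * ?d\<^sup>2 / t)) \<le> exp (c / 8) * exp (- (c / 16 * (dist x y)\<^sup>2 / t))"
        by (simp flip: exp_add)
      have "ball x s \<subseteq> ball (X (i x)) (2 * s)"
      proof
        fix y assume "y \<in> ball x s"
        then show "y \<in> ball (X (i x)) (2 * s)"
          using i[of x] dist_triangle[of "X (i x)" y x] by simp
      qed
      then have "measure M (ball x s) \<le> C0 * measure M (ball (X (i x)) s)"
        using ball_mono ball_double[OF s] order_trans by blast
      then have "B / measure M (ball (X (i x)) s) \<le> B * C0 / measure M (ball x s)"
        using ball_pos[OF s] B by (simp add: field_simps)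
      then have "w (i x) y \<le> B * C0 / measure M (ball x s) * (exp (c / 8) * exp (- (c / 16 * (dist x y)\<^sup>2 / t)))"
        unfolding w_def using e B C0_ge_2 by (intro mult_mono) auto
      then show ?thesis
        using K(2)[of "(x, y)"] by (simp add: W_def C'_def s_def)
    qed
    moreover have "AE x in M. integrable M (\<lambda>y. K (x, y) * f y)" if "integrable M f" for f
      using kernel_integrable[OF K(1,2) that] by (intro AE_I2)
    ultimately show ?thesis
      using K(1,3) by (intro exI[of _ K] conjI allI impI) auto
  qed
  then show ?thesis
    using C' pos by (intro exI[of _ C'] exI[of _ "c / 16"] conjI) auto
qed

end

text \<open>For the zero measure every statement holds almost everywhere, so each essential supremum
  lies below any right-hand side.\<close>

lemma off_diagonal_on_balls_null:
  assumes null: "space M \<in> null_sets M" and sets [measurable_cong]: "sets M = sets borel"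
    and D: "truncation_stable_subspace M D"
    and T: "\<And>t. 0 < t \<Longrightarrow> linear_operator_on M D (T t)"
  shows "off_diagonal_on_balls M 1 \<infinity> D T"
proof -
  have AE: "AE x in M. P x" for P
    using null by (intro AE_I'[of "space M"]) auto
  have "avg_norm M \<infinity> E A (T t (trunc Q f)) \<le> u"
    if "0 < t" "f \<in> D" and [measurable]: "A \<in> sets borel" and Q: "Q \<in> sets borel" for E A Q t f u
  proof -
    have "trunc Q f \<in> D"
      using D that(2) Q sets unfolding truncation_stable_subspace_def by blast
    then have [measurable]: "T t (trunc Q f) \<in> borel_measurable M"
      using T[OF that(1)] unfolding linear_operator_on_def operator_on_def by blast
    have "esssup M (\<lambda>x. indicator A x * ennreal (norm (T t (trunc Q f) x))) \<le> u"
      by (intro esssup_I AE) measurable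
    then show ?thesis by (simp add: avg_norm_def)
  qed
  moreover have "annulus x r j \<in> sets borel" for x :: 'a and r j
    unfolding annulus_def by simp
  ultimately show ?thesis
    unfolding off_diagonal_on_balls_def
    by - ((rule exI[of _ "1::real"], rule conjI[OF zero_less_one])+, auto)
qed

text \<open>The integrability clause accompanies the representation because the Bochner integral of
  a non-integrable function is 0 by convention; it makes the kernel integral meaningful for every
  integrable \<open>f\<close>.\<close>

theorem proposition2p2:
  fixes M :: "('a::metric_space) measure"
    and D :: "('a \<Rightarrow> complex) set"
    and T :: "real \<Rightarrow> ('a \<Rightarrow> complex) \<Rightarrow> 'a \<Rightarrow> complex"
  assumes "space_of_homogeneous_type M"
    and "D \<subseteq> {f. integrable M f}"
    and "truncation_stable_subspace M D"
    and "\<And>t. 0 < t \<Longrightarrow> linear_operator_on M D (T t)"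
    and "\<And>t. 0 < t \<Longrightarrow> determined_by_truncations M D (T t)"
  shows "off_diagonal_on_balls M 1 \<infinity> D T \<longleftrightarrow>
    (\<exists>C>0. \<exists>c>0. \<forall>t>0. \<exists>K :: 'a \<times> 'a \<Rightarrow> complex.
        K \<in> borel_measurable (M \<Otimes>\<^sub>M M) \<and>
        (\<forall>f. integrable M f \<longrightarrow>
           (AE x in M. integrable M (\<lambda>y. K (x, y) * f y)) \<and>
           (f \<in> D \<longrightarrow> (AE x in M. T t f x = (\<integral>y. K (x, y) * f y \<partial>M)))) \<and>
        (AE (x, y) in M \<Otimes>\<^sub>M M.
           norm (K (x, y)) \<le> C / measure M (ball x (sqrt t)) * exp (- (c * (dist x y)\<^sup>2 / t))))"
  using assms(1)
proof (cases rule: homogeneous_type_cases)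
  case 1
  have AE: "AE x in M. P x" for P
    using 1 by (intro AE_I'[of "space M"]) auto
  have "off_diagonal_on_balls M 1 \<infinity> D T"
    using 1 assms by (intro off_diagonal_on_balls_null) (auto simp: space_of_homogeneous_type_def)
  then show ?thesis
    by (auto intro!: exI[of _ "1::real"] exI[of _ "\<lambda>z. 0"] AE)
next
  case (2 C0)
  then interpret doubling_measure M C0 .
  show ?thesis
  proof
    assume "off_diagonal_on_balls M 1 \<infinity> D T"
    with assms show "\<exists>C>0. \<exists>c>0. \<forall>t>0. \<exists>K :: 'a \<times> 'a \<Rightarrow> complex.
        K \<in> borel_measurable (M \<Otimes>\<^sub>M M) \<and>
        (\<forall>f. integrable M f \<longrightarrow>
           (AE x in M. integrable M (\<lambda>y. K (x, y) * f y)) \<and>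
           (f \<in> D \<longrightarrow> (AE x in M. T t f x = (\<integral>y. K (x, y) * f y \<partial>M)))) \<and>
        (AE (x, y) in M \<Otimes>\<^sub>M M.
           norm (K (x, y)) \<le> C / measure M (ball x (sqrt t)) * exp (- (c * (dist x y)\<^sup>2 / t)))"
      by (intro off_diagonal_imp_kernel)
  next
    assume "\<exists>C>0. \<exists>c>0. \<forall>t>0. \<exists>K :: 'a \<times> 'a \<Rightarrow> complex.
        K \<in> borel_measurable (M \<Otimes>\<^sub>M M) \<and>
        (\<forall>f. integrable M f \<longrightarrow>
           (AE x in M. integrable M (\<lambda>y. K (x, y) * f y)) \<and>
           (f \<in> D \<longrightarrow> (AE x in M. T t f x = (\<integral>y. K (x, y) * f y \<partial>M)))) \<and>
        (AE (x, y) in M \<Otimes>\<^sub>M M.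
           norm (K (x, y)) \<le> C / measure M (ball x (sqrt t)) * exp (- (c * (dist x y)\<^sup>2 / t)))"
    then obtain C c where "0 < C" "0 < c" and K: "\<forall>t>0. \<exists>K :: 'a \<times> 'a \<Rightarrow> complex.
        K \<in> borel_measurable (M \<Otimes>\<^sub>M M) \<and>
        (\<forall>f. integrable M f \<longrightarrow>
           (AE x in M. integrable M (\<lambda>y. K (x, y) * f y)) \<and>
           (f \<in> D \<longrightarrow> (AE x in M. T t f x = (\<integral>y. K (x, y) * f y \<partial>M)))) \<and>
        (AE (x, y) in M \<Otimes>\<^sub>M M.
           norm (K (x, y)) \<le> C / measure M (ball x (sqrt t)) * exp (- (c * (dist x y)\<^sup>2 / t)))"
      by blast
    show "off_diagonal_on_balls M 1 \<infinity> D T"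
      using assms(2-4) \<open>0 < C\<close> \<open>0 < c\<close> K[rule_format] by (rule kernel_imp_off_diagonal)
  qed
qed

end
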